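(* There exist universal constants $D,K>0$, a universal constant $c>0$, and a Banach space $X$ such that both of the following hold. (1) For every $n\in\mathbb{N}$ and every $x_1,\ldots,x_n\in X$ there exist a linear subspace $F\subseteq X$, of dimension at most $K\log n$, and a linear mapping $S:X\to F$ such that $$\|x_i-x_j\|\le\|S(x_i)-S(x_j)\|\le D\|x_i-x_j\|\qquad\text{for all } i,j\in\{1,\ldots,n\}.$$ (2) For every integer $n\ge 1$ the space $X$ has an $n$-dimensional linear subspace $F_n\subseteq X$ with $$c_2(F_n)\ge 2^{c\,\alpha(n)},$$ where $\alpha(n)\to\infty$ is the inverse Ackermann function.
   Context: Banach spaces are over the real numbers, $\mathbb{N}=\{1,2,3,\ldots\}$, and $\log$ is the natural logarithm. Euclidean distortion: for a finite dimensional normed space $E$, $c_2(E)$ is the infimum over all $D'>0$ for which there exists a linear mapping $T:E\to\ell_2$ satisfying $\|x\|\le\|T(x)\|_2\le D'\|x\|$ for all $x\in E$. Inverse Ackermann function: define inductively functions $g_k:\mathbb{N}\to\mathbb{N}$, $k\ge 0$, by $g_0(n)=n+1$ and $g_{i+1}(n)=g_i^{(n)}(n)$, where $g_i^{(n)}$ denotes the $n$-fold iterate of $g_i$ (i.e. $g_i^{(1)}=g_i$ and $g_i^{(n+1)}(j)=g_i(g_i^{(n)}(j))$). Then $\alpha$ is the inverse of the function $k\mapsto g_k(2)$, i.e. for an integer $n>g_0(2)=3$, $\alpha(n)$ is the unique integer $k\ge 0$ such that $g_k(2)<n\le g_{k+1}(2)$; by convention $\alpha(n)=0$ for $1\le n\le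 3$. *)

theory Defs
  imports "HOL-Analysis.Analysis" "HOL-Library.Function_Algebras"
begin

text \<open>
  Pointwise scalar multiplication on functions. Together with the pointwise operations of
  \<^theory>\<open>HOL-Library.Function_Algebras\<close>, this makes real sequences a real vector space, so that
  the library notions \<^const>\<open>subspace\<close>, \<^const>\<open>span\<close> and \<^const>\<open>dim\<close> apply to them.
\<close>

instantiation "fun" :: (type, real_vector) real_vector
begin

definition scaleR_fun :: "real \<Rightarrow> ('a \<Rightarrow> 'b) \<Rightarrow> 'a \<Rightarrow> 'b"
  where "scaleR_fun r f = (\<lambda>x. r *\<^sub>R f x)"

instance
  by standard
    (simp_all add: scaleR_fun_def plus_fun_def fun_eq_iff scaleR_add_right scaleR_add_left)

end

text \<open>
  Banach spaces are represented by a carrier (a linear subspace of an ambient real vector space)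
  together with a norm function, of which only the values on the carrier matter. This allows one
  to quantify existentially over Banach spaces inside a formula.
\<close>

definition normed_space_on :: "'a::real_vector set \<Rightarrow> ('a \<Rightarrow> real) \<Rightarrow> bool"
  where "normed_space_on V N \<longleftrightarrow>
    subspace V \<and>
    (\<forall>x\<in>V. 0 \<le> N x) \<and>
    (\<forall>x\<in>V. N x = 0 \<longleftrightarrow> x = 0) \<and>
    (\<forall>r. \<forall>x\<in>V. N (r *\<^sub>R x) = \<bar>r\<bar> * N x) \<and>
    (\<forall>x\<in>V. \<forall>y\<in>V. N (x + y) \<le> N x + N y)"

definition banach_space_on :: "'a::real_vector set \<Rightarrow> ('a \<Rightarrow> real) \<Rightarrow> bool"
  where "banach_space_on V N \<longleftrightarrow>
    normed_space_on V N \<and>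
    (\<forall>u :: nat \<Rightarrow> 'a. (\<forall>n. u n \<in> V) \<longrightarrow>
      (\<forall>e>0. \<exists>M. \<forall>m\<ge>M. \<forall>n\<ge>M. N (u m - u n) < e) \<longrightarrow>
      (\<exists>l\<in>V. (\<lambda>n. N (u n - l)) \<longlonglongrightarrow> 0))"

text \<open>
  The library's \<^const>\<open>dim\<close> is 0 on infinite-dimensional subspaces, so a bound on the dimension
  has to be accompanied by this predicate.
\<close>

definition finite_dim :: "'a::real_vector set \<Rightarrow> bool"
  where "finite_dim F \<longleftrightarrow> (\<exists>B. finite B \<and> span B = F)"

definition linear_map_on ::
    "'a::real_vector set \<Rightarrow> 'b::real_vector set \<Rightarrow> ('a \<Rightarrow> 'b) \<Rightarrow> bool"
  where "linear_map_on V W T \<longleftrightarrow>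
    (\<forall>x\<in>V. T x \<in> W) \<and>
    (\<forall>x\<in>V. \<forall>y\<in>V. T (x + y) = T x + T y) \<and>
    (\<forall>r. \<forall>x\<in>V. T (r *\<^sub>R x) = r *\<^sub>R T x)"

definition ell2 :: "(nat \<Rightarrow> real) set"
  where "ell2 = {f. summable (\<lambda>k. (f k)\<^sup>2)}"

definition ell2_norm :: "(nat \<Rightarrow> real) \<Rightarrow> real"
  where "ell2_norm f = sqrt (\<Sum>k. (f k)\<^sup>2)"

text \<open>
  The Euclidean distortion \<open>c\<^sub>2(E)\<close> of the normed space with carrier \<open>E\<close> and norm \<open>N\<close>. The infimum
  is taken in the extended reals only so that it is meaningful without a side condition; for
  finite-dimensional \<open>E\<close> the set is nonempty and the value is a real number.
\<close>

definition euclidean_distortion :: "'a::real_vector set \<Rightarrow> ('a \<Rightarrow> real) \<Rightarrow> ereal"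
  where "euclidean_distortion E N =
    Inf (ereal ` {D'. 0 < D' \<and>
      (\<exists>T. linear_map_on E ell2 T \<and>
        (\<forall>x\<in>E. N x \<le> ell2_norm (T x) \<and> ell2_norm (T x) \<le> D' * N x))})"

primrec ackermann_g :: "nat \<Rightarrow> nat \<Rightarrow> nat"
  where
    "ackermann_g 0 = (\<lambda>n. n + 1)"
  | "ackermann_g (Suc i) = (\<lambda>n. (ackermann_g i ^^ n) n)"

definition inverse_ackermann :: "nat \<Rightarrow> nat"
  where "inverse_ackermann n =
    (if n \<le> 3 then 0 else (THE k. ackermann_g k 2 < n \<and> n \<le> ackermann_g (Suc k) 2))"

end

theory Submission
  imports Defs
begin

text \<open>
  The space is the 2-convexification of a Tsirelson-type space in which any \<open>2^2^m\<close> disjoint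
  vectors supported beyond \<open>m\<close> span a space that is 2-isomorphic to a weighted \<open>\<ell>\<^sub>1\<close>; after
  2-convexification they span an almost Euclidean space.

  To embed \<open>n\<close> points, keep the first \<open>m = O(log n)\<close> coordinates. Beyond them, rounding the
  ratios of the values of the at most \<open>n\<^sup>2\<close> differences of the points to multiples of
  \<open>1/O(n\<^sup>2)\<close> splits the coordinates into at most \<open>2^2^m\<close> classes on which the points are almost
  proportional to a common vector. So the tails lie almost in an almost Euclidean subspace, to
  which the Johnson--Lindenstrauss lemma applies; its target is the span of the next \<open>m\<close> unit
  vectors.

  The unit basis is unconditional, so the Euclidean distortion of a coordinate subspace is at least
  \<open>\<parallel>a\<parallel>\<^sup>-\<^sup>1\<^sup>/\<^sup>2\<close> for each probability vector \<open>a\<close> on the coordinates, with the norm before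
  2-convexification. It is at most \<open>2\<^sup>-\<^sup>j\<close> for a repeated average on the coordinates below
  \<open>g\<^sub>4\<^sub>+\<^sub>2\<^sub>j(2)\<close>, which gives every \<open>j\<close>-th Schreier set small mass.
\<close>

subsection \<open>The Ackermann hierarchy\<close>

text \<open>The threshold \<open>a\<close> accommodates the Ackermann levels: those of positive
  index fix 0 and grow strictly only from 1 on.\<close>

lemma funpow_strict_growth:
  fixes h :: "nat \<Rightarrow> nat"
  assumes "\<And>x. x \<ge> a \<Longrightarrow> x < h x" and "a \<le> x" and "i < j"
  shows "(h ^^ i) x < (h ^^ j) x"
proof -
  have ge: "a \<le> (h ^^ k) x" for k
  proof (induction k)
    case (Suc k)
    then show ?case using assms(1)[of "(h ^^ k) x"] by simp
  qed (simp add: assms(2))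
  have "(h ^^ k) x < (h ^^ Suc k) x" for k
    using assms(1)[OF ge[of k]] by simp
  then have "strict_mono (\<lambda>k. (h ^^ k) x)"
    by (simp add: strict_mono_Suc_iff)
  then show ?thesis using \<open>i < j\<close> by (simp add: strict_mono_def)
qed

lemma funpow_mono_le:
  fixes h k :: "nat \<Rightarrow> nat"
  assumes "mono h" and "\<And>x. a \<le> x \<Longrightarrow> x \<le> h x" and "\<And>x. a \<le> x \<Longrightarrow> h x \<le> k x"
    and "a \<le> x" and "x \<le> y" and "i \<le> j"
  shows "(h ^^ i) x \<le> (k ^^ j) y"
proof -
  have "(h ^^ i) x \<le> (k ^^ i) y \<and> a \<le> (k ^^ i) y" for i
  proof (induction i)
    case 0
    then show ?case using assms by simp
  next
    case (Suc i)
    have "h ((h ^^ i) x) \<le> h ((k ^^ i) y)" using Suc assms(1) by (simp add: monoD)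
    also have "\<dots> \<le> k ((k ^^ i) y)" using Suc assms(3) by simp
    finally show ?case using Suc assms(2)[of "(k ^^ i) y"] assms(3)[of "(k ^^ i) y"] by simp
  qed
  note * = this
  have "(k ^^ i) y \<le> (k ^^ (i + d)) y" for d
  proof (induction d)
    case (Suc d)
    have "(k ^^ (i + d)) y \<le> k ((k ^^ (i + d)) y)"
      using *[of "i + d"] assms(2,3) order_trans by blast
    then show ?case using Suc by simp
  qed simp
  from this[of "j - i"] *[of i] \<open>i \<le> j\<close> show ?thesis by simp
qed

lemma ackermann_g_props:
  "mono (ackermann_g i) \<and> (\<forall>x. x \<le> ackermann_g i x) \<and> (\<forall>x\<ge>1. x < ackermann_g i x)"
proof (induction i)
  case 0
  then show ?case by (auto simp: mono_def)
next
  case (Suc i)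
  let ?h = "ackermann_g i"
  have "mono (ackermann_g (Suc i))"
    using Suc by (auto simp: mono_def intro!: funpow_mono_le[where a = 0])
  moreover have "x < ackermann_g (Suc i) x" if "x \<ge> 1" for x
    using Suc funpow_strict_growth[of 1 ?h x 0 x] that by simp
  moreover have "x \<le> ackermann_g (Suc i) x" for x
    using calculation(2)[of x] by (cases "x = 0") auto
  ultimately show ?case by blast
qed

lemmas ackermann_g_mono = ackermann_g_props[THEN conjunct1]

lemma ackermann_g_gt: "1 \<le> x \<Longrightarrow> x < ackermann_g i x"
  using ackermann_g_props by blast

text \<open>An \<open>x\<close>-fold iterate contains at least two steps once
  \<open>2 \<le> x\<close>. Going up one level thus absorbs one composition, which is how the nested
  bounds below are collapsed.\<close>

lemma ackermann_g_twice_le: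
  assumes "2 \<le> x"
  shows "ackermann_g i (ackermann_g i x) \<le> ackermann_g (Suc i) x"
proof -
  have "(ackermann_g i ^^ 2) x \<le> (ackermann_g i ^^ x) x"
    using assms by (intro funpow_mono_le[where a = 0]) (auto simp: ackermann_g_props)
  then show ?thesis by (simp add: numeral_2_eq_2)
qed

lemma ackermann_g_le_Suc: "2 \<le> x \<Longrightarrow> ackermann_g i x \<le> ackermann_g (Suc i) x"
  using ackermann_g_twice_le[of x i] ackermann_g_props[of i] order_trans by blast

lemma ackermann_g_le_add: "2 \<le> x \<Longrightarrow> ackermann_g i x \<le> ackermann_g (i + d) x"
  by (induction d) (auto intro: order_trans ackermann_g_le_Suc simp del: ackermann_g.simps)

lemma ackermann_g_strict_2: "strict_mono (\<lambda>k. ackermann_g k 2)"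
proof (simp add: strict_mono_Suc_iff del: ackermann_g.simps, rule allI)
  fix k
  show "ackermann_g k 2 < ackermann_g (Suc k) 2"
    using ackermann_g_twice_le[of 2 k] ackermann_g_gt[of 2 k]
      ackermann_g_gt[of "ackermann_g k 2" k] by linarith
qed

lemma ackermann_g_2_ge: "k + 3 \<le> ackermann_g k 2"
proof (induction k)
  case (Suc k)
  then show ?case using strict_monoD[OF ackermann_g_strict_2, of k "Suc k"] by simp
qed simp

section \<open>Explicit low levels and a double exponential\<close>

lemma ackermann_g_1: "ackermann_g (Suc 0) n = 2 * n"
proof -
  have "(Suc ^^ k) m = k + m" for k m by (induction k) auto
  moreover have "(\<lambda>n. n + 1) = Suc" by auto
  ultimately show ?thesis by (simp del: One_nat_def)
qed

lemma ackermann_g_2: "ackermann_g (Suc (Suc 0)) n = n * 2 ^ n"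
proof -
  have "((*) 2 ^^ k) m = 2 ^ k * m" for k and m :: nat by (induction k) auto
  moreover have "ackermann_g (Suc 0) = (*) 2" using ackermann_g_1 by auto
  ultimately show ?thesis by (subst ackermann_g.simps(2)) (metis mult.commute)
qed

text \<open>Two applications of \<open>n * 2 ^ n\<close> already put \<open>M * 2 ^ M\<close> into
  the exponent. Level 3 therefore dominates the double exponential of the admissibility condition,
  and the spread-out measures below start at this level.\<close>

lemma double_exp_le_ackermann_g_3:
  assumes "2 \<le> M"
  shows "4 * M * 2 ^ 2 ^ M \<le> ackermann_g 3 M"
proof -
  let ?x = "M * 2 ^ M :: nat"
  have "(4::nat) \<le> 2 ^ M" using power_increasing[of 2 M "2::nat"] assms by simp
  then have "4 * M \<le> ?x" by simp
  moreover have "(2::nat) ^ 2 ^ M \<le> 2 ^ ?x" using assms by (intro power_increasing) auto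
  ultimately have "4 * M * 2 ^ 2 ^ M \<le> ?x * 2 ^ ?x" by (rule mult_le_mono)
  also have "\<dots> = ackermann_g (Suc (Suc 0)) (ackermann_g (Suc (Suc 0)) M)"
    by (simp only: ackermann_g_2)
  also have "\<dots> \<le> ackermann_g 3 M"
    using ackermann_g_twice_le[OF assms, of "Suc (Suc 0)"] by (simp only: numeral_3_eq_3)
  finally show ?thesis .
qed

section \<open>The inverse Ackermann function\<close>

lemma inverse_ackermann_eq:
  assumes "ackermann_g k 2 < n" and "n \<le> ackermann_g (Suc k) 2"
  shows "inverse_ackermann n = k"
proof -
  have "n > 3" using assms(1) ackermann_g_2_ge[of k] by linarith
  moreover have "(THE k. ackermann_g k 2 < n \<and> n \<le> ackermann_g (Suc k) 2) = k"
  proof (rule the_equality)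
    fix l assume l: "ackermann_g l 2 < n \<and> n \<le> ackermann_g (Suc l) 2"
    have "\<not> l < k" "\<not> k < l"
      using l assms monoD[OF strict_mono_mono[OF ackermann_g_strict_2], of "Suc l" k]
        monoD[OF strict_mono_mono[OF ackermann_g_strict_2], of "Suc k" l]
      by (auto simp del: ackermann_g.simps)
    then show "l = k" by simp
  qed (use assms in simp)
  ultimately show ?thesis by (simp add: inverse_ackermann_def del: ackermann_g.simps)
qed

lemma inverse_ackermann_bounds:
  assumes "3 < n"
  shows "ackermann_g (inverse_ackermann n) 2 < n" "n \<le> ackermann_g (Suc (inverse_ackermann n)) 2"
proof -
  define l where "l = (LEAST l. n \<le> ackermann_g l 2)"
  have "n \<le> ackermann_g n 2" using ackermann_g_2_ge[of n] by simp
  then have l: "n \<le> ackermann_g l 2" unfolding l_def by (rule LeastI)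
  \<comment> \<open>\<open>l = 0\<close> is excluded by
    \<open>ackermann_g 0 2 = 3 < n\<close>.\<close>
  obtain k where k: "l = Suc k" using l assms by (cases l) auto
  have "ackermann_g k 2 < n"
    using not_less_Least[of k "\<lambda>l. n \<le> ackermann_g l 2"] k unfolding l_def by simp
  with l k inverse_ackermann_eq show "ackermann_g (inverse_ackermann n) 2 < n"
    "n \<le> ackermann_g (Suc (inverse_ackermann n)) 2" by (auto simp del: ackermann_g.simps)
qed

lemma inverse_ackermann_at_top: "filterlim inverse_ackermann at_top sequentially"
proof (unfold filterlim_at_top eventually_sequentially, intro allI exI impI)
  fix Z n assume n: "Suc (ackermann_g Z 2) \<le> n"
  then have "3 < n" using ackermann_g_2_ge[of Z] by linarith
  from inverse_ackermann_bounds(2)[OF this] n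
  have "ackermann_g Z 2 < ackermann_g (Suc (inverse_ackermann n)) 2" by linarith
  then have "Z < Suc (inverse_ackermann n)"
    using strict_mono_less[OF ackermann_g_strict_2] by blast
  then show "Z \<le> inverse_ackermann n" by simp
qed

subsection \<open>The two-convexified Tsirelson-type space\<close>

text \<open>Doubly exponential growth makes \<open>adm m\<close> exceed the number of rounding
  classes of \<open>n\<close> points already for \<open>m = O(log n)\<close>; see
  \<open>quantization_classes_le_adm\<close>.\<close>

definition adm :: "nat \<Rightarrow> nat" where "adm m = 2 ^ 2 ^ m"

definition unit_vec :: "nat \<Rightarrow> nat \<Rightarrow> real" where "unit_vec i = (\<lambda>t. if t = i then 1 else 0)"

text \<open>The supports in a node are disjoint but may interleave, as rounding classes do.
  Coefficients are non-negative, so testing squares against a functional gives the square of a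
  weighted Euclidean seminorm.\<close>

inductive_set norming :: "(nat \<Rightarrow> real) set" where
  unit_norming: "unit_vec i \<in> norming"
| tree_norming: "L \<le> adm m \<Longrightarrow> (\<And>l. l < L \<Longrightarrow> w l \<in> norming) \<Longrightarrow>
    (\<And>l t. l < L \<Longrightarrow> t < m \<Longrightarrow> w l t = 0) \<Longrightarrow>
    (\<And>l l' t. l < L \<Longrightarrow> l' < L \<Longrightarrow> l \<noteq> l' \<Longrightarrow> w l t = 0 \<or> w l' t = 0) \<Longrightarrow>
    (\<lambda>t. (\<Sum>l<L. w l t) / 2) \<in> norming"

definition pairing :: "(nat \<Rightarrow> real) \<Rightarrow> (nat \<Rightarrow> real) \<Rightarrow> real" where
  "pairing w a = (\<Sum>t | w t \<noteq> 0. w t * a t)"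

definition tsirelson :: "(nat \<Rightarrow> real) set" where
  "tsirelson = {x. bdd_above ((\<lambda>w. pairing w (\<lambda>t. (x t)\<^sup>2)) ` norming)}"

definition tnorm :: "(nat \<Rightarrow> real) \<Rightarrow> real" where
  "tnorm x = sqrt (SUP w\<in>norming. pairing w (\<lambda>t. (x t)\<^sup>2))"

lemma adm_mono: "m \<le> n \<Longrightarrow> adm m \<le> adm n"
  by (simp add: adm_def)

lemma le_adm: "m \<le> adm m"
  unfolding adm_def by (metis less_exp less_le_not_le order_less_trans)

lemma adm_ge_2: "2 \<le> adm m"
  using power_increasing[of 1 "2 ^ m" "2::nat"] by (simp add: adm_def)

text \<open>Under disjointness a node of the tree never adds two nonzero values at a coordinate.
  Pointwise bounds for norming functionals pass through nodes by this case split.\<close>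

lemma disjoint_sum_cases:
  fixes w :: "nat \<Rightarrow> nat \<Rightarrow> real"
  assumes "\<And>l l'. l < L \<Longrightarrow> l' < L \<Longrightarrow> l \<noteq> l' \<Longrightarrow> w l t = 0 \<or> w l' t = 0"
  obtains "(\<Sum>l<L. w l t) = 0" | l where "l < L" "(\<Sum>l<L. w l t) = w l t"
proof (cases "\<exists>l<L. w l t \<noteq> 0")
  case True
  then obtain l where l: "l < L" "w l t \<noteq> 0" by blast
  then have "(\<Sum>l'<L. w l' t) = (\<Sum>l'<L. if l' = l then w l t else 0)"
    using assms by (intro sum.cong) auto
  then show ?thesis using l that(2) by simp
qed (auto intro: that(1))

lemma norming_basic:
  assumes "w \<in> norming"
  shows "finite {t. w t \<noteq> 0} \<and> (\<forall>t. 0 \<le> w t \<and> w t \<le> 1)"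
  using assms
proof induction
  case (unit_norming i)
  then show ?case by (auto simp: unit_vec_def)
next
  case (tree_norming L m w)
  have "{t. (\<Sum>l<L. w l t) / 2 \<noteq> 0} \<subseteq> (\<Union>l<L. {t. w l t \<noteq> 0})"
  proof (rule subsetI)
    fix t assume "t \<in> {t. (\<Sum>l<L. w l t) / 2 \<noteq> 0}"
    then have "(\<Sum>l<L. w l t) \<noteq> 0" by simp
    then obtain l where "l \<in> {..<L}" "w l t \<noteq> 0"
      using sum.not_neutral_contains_not_neutral by blast
    then show "t \<in> (\<Union>l<L. {t. w l t \<noteq> 0})" by blast
  qed
  then have "finite {t. (\<Sum>l<L. w l t) / 2 \<noteq> 0}"
    using tree_norming by (auto intro: finite_subset)
  moreover have "0 \<le> (\<Sum>l<L. w l t) / 2 \<and> (\<Sum>l<L. w l t) / 2 \<le> 1" for t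
  proof (rule disjoint_sum_cases[of L w t])
    show "w l t = 0 \<or> w l' t = 0" if "l < L" "l' < L" "l \<noteq> l'" for l l'
      using tree_norming that by blast
    show ?thesis if "(\<Sum>l<L. w l t) = 0" using that by simp
    show ?thesis if "l < L" "(\<Sum>l<L. w l t) = w l t" for l
    proof -
      have "0 \<le> w l t \<and> w l t \<le> 1" using tree_norming that(1) by blast
      then show ?thesis using that by simp
    qed
  qed
  ultimately show ?case by simp
qed

lemmas norming_finite = norming_basic[THEN conjunct1]

lemma norming_nonneg: "w \<in> norming \<Longrightarrow> 0 \<le> w t" and norming_le_1: "w \<in> norming \<Longrightarrow> w t \<le> 1"
  using norming_basic by blast+

lemma zero_norming: "(\<lambda>_. 0) \<in> norming"
  using tree_norming[of 0 0] by simp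

text \<open>Restriction acts on the leaves of the tree: those outside \<open>A\<close> become the
  zero functional, the rest stay. This confines an almost norming functional to one class of
  coordinates.\<close>

lemma norming_restrict: "w \<in> norming \<Longrightarrow> (\<lambda>t. if t \<in> A then w t else 0) \<in> norming"
proof (induction rule: norming.induct)
  case (unit_norming i)
  have "(\<lambda>t. if t \<in> A then unit_vec i t else 0) = (if i \<in> A then unit_vec i else (\<lambda>_. 0))"
    by (auto simp: unit_vec_def)
  then show ?case using norming.unit_norming zero_norming by simp
next
  case (tree_norming L m w)
  have "(\<lambda>t. (\<Sum>l<L. (\<lambda>t. if t \<in> A then w l t else 0) t) / 2) \<in> norming"
    by (rule norming.tree_norming[of L m]) (simp_all add: tree_norming)
  moreover have "(\<lambda>t. (\<Sum>l<L. if t \<in> A then w l t else 0) / 2)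
      = (\<lambda>t. if t \<in> A then (\<Sum>l<L. w l t) / 2 else 0)" by auto
  ultimately show ?case by simp
qed

lemma pairing_eq:
  assumes "finite B" and "\<And>t. t \<notin> B \<Longrightarrow> w t = 0"
  shows "pairing w a = (\<Sum>t\<in>B. w t * a t)"
  unfolding pairing_def using assms by (intro sum.mono_neutral_left) auto

lemma pairing_nonneg: "w \<in> norming \<Longrightarrow> (\<And>t. 0 \<le> a t) \<Longrightarrow> 0 \<le> pairing w a"
  unfolding pairing_def by (intro sum_nonneg) (auto simp: norming_nonneg)

lemma pairing_mono:
  "w \<in> norming \<Longrightarrow> (\<And>t. w t \<noteq> 0 \<Longrightarrow> a t \<le> b t) \<Longrightarrow> pairing w a \<le> pairing w b"
  unfolding pairing_def by (intro sum_mono mult_left_mono) (auto simp: norming_nonneg)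

lemma pairing_unit_vec: "pairing (unit_vec i) a = a i"
  by (subst pairing_eq[of "{i}"]) (auto simp: unit_vec_def)

lemma pairing_restrict:
  assumes "w \<in> norming"
  shows "pairing (\<lambda>t. if t \<in> A then w t else 0) a = pairing w (\<lambda>t. if t \<in> A then a t else 0)"
proof -
  have "pairing (\<lambda>t. if t \<in> A then w t else 0) a = (\<Sum>t | w t \<noteq> 0. (if t \<in> A then w t else 0) * a t)"
    by (rule pairing_eq[OF norming_finite[OF assms]]) simp
  also have "\<dots> = pairing w (\<lambda>t. if t \<in> A then a t else 0)"
    unfolding pairing_def by (intro sum.cong) auto
  finally show ?thesis .
qed

section \<open>The norm as a supremum of weighted Euclidean seminorms\<close>

lemma tnorm_upper:
  assumes "x \<in> tsirelson" "w \<in> norming"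
  shows "pairing w (\<lambda>t. (x t)\<^sup>2) \<le> (tnorm x)\<^sup>2"
proof -
  have "pairing w (\<lambda>t. (x t)\<^sup>2) \<le> (SUP w\<in>norming. pairing w (\<lambda>t. (x t)\<^sup>2))"
    using assms by (intro cSUP_upper) (auto simp: tsirelson_def)
  moreover have "0 \<le> pairing w (\<lambda>t. (x t)\<^sup>2)" using assms by (intro pairing_nonneg) auto
  ultimately show ?thesis by (simp add: tnorm_def)
qed

lemma tnorm_nonneg: "0 \<le> tnorm x" if "x \<in> tsirelson"
proof -
  have "0 \<le> pairing (\<lambda>_. 0) (\<lambda>t. (x t)\<^sup>2)" by (simp add: pairing_def)
  also have "\<dots> \<le> (SUP w\<in>norming. pairing w (\<lambda>t. (x t)\<^sup>2))"
    using that zero_norming by (intro cSUP_upper) (auto simp: tsirelson_def)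
  finally show ?thesis by (simp add: tnorm_def)
qed

lemma tnorm_leI:
  assumes "\<And>w. w \<in> norming \<Longrightarrow> pairing w (\<lambda>t. (x t)\<^sup>2) \<le> C\<^sup>2" and "0 \<le> C"
  shows "x \<in> tsirelson" "tnorm x \<le> C"
proof -
  show "x \<in> tsirelson" using assms by (auto simp: tsirelson_def intro!: bdd_aboveI2)
  have "(SUP w\<in>norming. pairing w (\<lambda>t. (x t)\<^sup>2)) \<le> C\<^sup>2"
    using assms zero_norming by (intro cSUP_least) auto
  then show "tnorm x \<le> C" using assms(2) by (auto simp: tnorm_def intro: real_le_lsqrt)
qed

lemma tnorm_square_leI:
  assumes "\<And>w. w \<in> norming \<Longrightarrow> pairing w (\<lambda>t. (x t)\<^sup>2) \<le> C" and "0 \<le> C"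
  shows "x \<in> tsirelson" "(tnorm x)\<^sup>2 \<le> C"
proof -
  show *: "x \<in> tsirelson" using tnorm_leI[of x "sqrt C"] assms by simp
  show "(tnorm x)\<^sup>2 \<le> C"
    using power_mono[OF tnorm_leI(2)[of x "sqrt C"] tnorm_nonneg[OF *], of 2] assms by simp
qed

text \<open>This reduces the triangle inequality for \<open>tnorm\<close> to Minkowski's inequality
  for each single functional.\<close>

lemma pairing_square_L2:
  "w \<in> norming \<Longrightarrow>
    pairing w (\<lambda>t. (x t)\<^sup>2) = (L2_set (\<lambda>t. sqrt (w t) * x t) {t. w t \<noteq> 0})\<^sup>2"
  unfolding pairing_def L2_set_def
  by (subst real_sqrt_pow2) (auto simp: norming_nonneg power_mult_distrib intro!: sum_nonneg sum.cong)

lemma tnorm_triangle: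
  assumes "x \<in> tsirelson" "y \<in> tsirelson"
  shows "(\<lambda>t. x t + y t) \<in> tsirelson" "tnorm (\<lambda>t. x t + y t) \<le> tnorm x + tnorm y"
proof -
  have "pairing w (\<lambda>t. (x t + y t)\<^sup>2) \<le> (tnorm x + tnorm y)\<^sup>2" if w: "w \<in> norming" for w
  proof -
    let ?n = "\<lambda>x. L2_set (\<lambda>t. sqrt (w t) * x t) {t. w t \<noteq> 0}"
    have le: "?n z \<le> tnorm z" if "z \<in> tsirelson" for z
      by (rule power2_le_imp_le[OF _ tnorm_nonneg[OF that]])
        (use tnorm_upper[OF that w] in \<open>simp add: pairing_square_L2[OF w]\<close>)
    have "?n (\<lambda>t. x t + y t) \<le> ?n x + ?n y"
      using L2_set_triangle_ineq[of "\<lambda>t. sqrt (w t) * x t" "\<lambda>t. sqrt (w t) * y t" "{t. w t \<noteq> 0}"]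
      by (simp add: algebra_simps)
    also have "\<dots> \<le> tnorm x + tnorm y" by (intro add_mono le assms)
    finally show ?thesis
      unfolding pairing_square_L2[OF w] by (intro power_mono L2_set_nonneg)
  qed
  from tnorm_leI[OF this] show "(\<lambda>t. x t + y t) \<in> tsirelson"
    "tnorm (\<lambda>t. x t + y t) \<le> tnorm x + tnorm y"
    using tnorm_nonneg assms by auto
qed

text \<open>The lattice property, from monotonicity of non-negative functionals on squares. It
  contains unconditionality and the boundedness of coordinate restrictions.\<close>

lemma tnorm_mono:
  assumes "y \<in> tsirelson" "\<And>t. \<bar>x t\<bar> \<le> c * \<bar>y t\<bar>" "0 \<le> c"
  shows "x \<in> tsirelson" "tnorm x \<le> c * tnorm y"
proof -
  have "pairing w (\<lambda>t. (x t)\<^sup>2) \<le> (c * tnorm y)\<^sup>2" if w: "w \<in> norming" for w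
  proof -
    have "(x t)\<^sup>2 \<le> c\<^sup>2 * (y t)\<^sup>2" for t
      using power_mono[OF assms(2)[of t] abs_ge_zero, of 2] by (simp add: power_mult_distrib)
    then have "pairing w (\<lambda>t. (x t)\<^sup>2) \<le> pairing w (\<lambda>t. c\<^sup>2 * (y t)\<^sup>2)"
      by (intro pairing_mono w)
    also have "\<dots> = c\<^sup>2 * pairing w (\<lambda>t. (y t)\<^sup>2)"
      by (simp add: pairing_def sum_distrib_left algebra_simps)
    also have "\<dots> \<le> c\<^sup>2 * (tnorm y)\<^sup>2"
      by (intro mult_left_mono tnorm_upper assms w) auto
    finally show ?thesis by (simp add: power_mult_distrib)
  qed
  from tnorm_leI[OF this] show "x \<in> tsirelson" "tnorm x \<le> c * tnorm y"
    using tnorm_nonneg assms by auto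
qed

lemma tnorm_scale:
  assumes "x \<in> tsirelson"
  shows "(\<lambda>t. c * x t) \<in> tsirelson" "tnorm (\<lambda>t. c * x t) = \<bar>c\<bar> * tnorm x"
proof -
  show *: "(\<lambda>t. c * x t) \<in> tsirelson"
    by (rule tnorm_mono(1)[OF assms, where c = "\<bar>c\<bar>"]) (auto simp: abs_mult)
  show "tnorm (\<lambda>t. c * x t) = \<bar>c\<bar> * tnorm x"
  proof (cases "c = 0")
    case True
    have "tnorm (\<lambda>t. c * x t) \<le> 0" by (rule tnorm_leI(2)) (auto simp: True pairing_def)
    then show ?thesis using tnorm_nonneg[OF *] True by simp
  next
    case False
    have "tnorm (\<lambda>t. c * x t) \<le> \<bar>c\<bar> * tnorm x"
      by (rule tnorm_mono(2)[OF assms]) (auto simp: abs_mult)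
    moreover have "tnorm x \<le> (1 / \<bar>c\<bar>) * tnorm (\<lambda>t. c * x t)"
      by (rule tnorm_mono(2)[OF *]) (auto simp: abs_mult False)
    ultimately show ?thesis using False by (simp add: field_simps)
  qed
qed

lemma coord_le_tnorm:
  assumes "x \<in> tsirelson"
  shows "\<bar>x t\<bar> \<le> tnorm x"
  by (rule power2_le_imp_le[OF _ tnorm_nonneg[OF assms]])
    (use tnorm_upper[OF assms unit_norming[of t]] in \<open>simp add: pairing_unit_vec\<close>)

lemma tnorm_zero: "(\<lambda>_. 0) \<in> tsirelson" "tnorm (\<lambda>_. 0) = 0"
proof -
  show 1: "(\<lambda>_. 0) \<in> tsirelson" by (rule tnorm_leI(1)[of _ 0]) (auto simp: pairing_def)
  show "tnorm (\<lambda>_. 0) = 0" using tnorm_scale(2)[OF 1, of 0] by simp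
qed

lemma tsirelson_subspace: "subspace tsirelson"
  unfolding subspace_def plus_fun_def scaleR_fun_def
  using tnorm_triangle tnorm_scale tnorm_zero by (auto simp: func_zero)

lemma tsirelson_diff: "x \<in> tsirelson \<Longrightarrow> y \<in> tsirelson \<Longrightarrow> (\<lambda>t. x t - y t) \<in> tsirelson"
  using tnorm_triangle(1)[OF _ tnorm_scale(1), of x y "- 1"] by simp

lemma tsirelson_normed: "normed_space_on tsirelson tnorm"
  unfolding normed_space_on_def
proof (intro conjI ballI allI tsirelson_subspace tnorm_nonneg)
  fix x assume x: "x \<in> tsirelson"
  show "tnorm x = 0 \<longleftrightarrow> x = 0"
    using coord_le_tnorm[OF x] tnorm_zero by (auto simp: func_zero)
  show "tnorm (r *\<^sub>R x) = \<bar>r\<bar> * tnorm x" for r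
    using tnorm_scale(2)[OF x, of r] by (simp add: scaleR_fun_def)
  show "tnorm (x + y) \<le> tnorm x + tnorm y" if "y \<in> tsirelson" for y
    using tnorm_triangle(2)[OF x that] by (simp add: func_plus)
qed

lemma tsirelson_banach: "banach_space_on tsirelson tnorm"
  unfolding banach_space_on_def
proof (intro conjI tsirelson_normed allI impI)
  fix u :: "nat \<Rightarrow> nat \<Rightarrow> real"
  assume u: "\<forall>n. u n \<in> tsirelson"
    and cauchy: "\<forall>e>0. \<exists>M. \<forall>m\<ge>M. \<forall>n\<ge>M. tnorm (u m - u n) < e"
  have diff: "(\<lambda>t. u m t - u n t) \<in> tsirelson" for m n using u by (intro tsirelson_diff) auto
  have "Cauchy (\<lambda>n. u n t)" for t
  proof (rule metric_CauchyI)
    fix e :: real assume "0 < e"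
    then obtain M where M: "\<forall>m\<ge>M. \<forall>n\<ge>M. tnorm (u m - u n) < e" using cauchy by blast
    have "dist (u m t) (u n t) < e" if "m \<ge> M" "n \<ge> M" for m n
    proof -
      have "tnorm (\<lambda>t. u m t - u n t) < e" using M that by (simp add: fun_diff_def)
      then show ?thesis using coord_le_tnorm[OF diff, of m t n] by (simp add: dist_real_def)
    qed
    then show "\<exists>M. \<forall>m\<ge>M. \<forall>n\<ge>M. dist (u m t) (u n t) < e" by blast
  qed
  then have "\<forall>t. \<exists>l. (\<lambda>n. u n t) \<longlonglongrightarrow> l"
    using Cauchy_convergent unfolding convergent_def by blast
  from choice[OF this] obtain l where l: "\<And>t. (\<lambda>n. u n t) \<longlonglongrightarrow> l t" by blast
  have close: "\<exists>M. \<forall>m\<ge>M. (\<lambda>t. u m t - l t) \<in> tsirelson \<and> tnorm (\<lambda>t. u m t - l t) \<le> e"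
    if "0 < e" for e
  proof -
    obtain M where M: "\<forall>m\<ge>M. \<forall>n\<ge>M. tnorm (u m - u n) < e" using cauchy \<open>0 < e\<close> by blast
    \<comment> \<open>A single pairing is a finite sum, so it is continuous under coordinatewise
      limits; the bound passes to the limit before the supremum over \<open>w\<close> is
      taken.\<close>
    have "pairing w (\<lambda>t. (u m t - l t)\<^sup>2) \<le> e\<^sup>2" if "m \<ge> M" and w: "w \<in> norming" for m w
    proof (rule tendsto_upperbound[OF _ _ trivial_limit_sequentially])
      show "(\<lambda>n. pairing w (\<lambda>t. (u m t - u n t)\<^sup>2)) \<longlonglongrightarrow> pairing w (\<lambda>t. (u m t - l t)\<^sup>2)"
        unfolding pairing_def by (intro tendsto_intros l)
      have "pairing w (\<lambda>t. (u m t - u n t)\<^sup>2) \<le> e\<^sup>2" if "n \<ge> M" for n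
      proof -
        have "pairing w (\<lambda>t. (u m t - u n t)\<^sup>2) \<le> (tnorm (\<lambda>t. u m t - u n t))\<^sup>2"
          by (intro tnorm_upper diff w)
        also have "\<dots> \<le> e\<^sup>2"
          using M \<open>n \<ge> M\<close> \<open>m \<ge> M\<close> tnorm_nonneg[OF diff, of m n]
          by (intro power_mono) (auto simp: fun_diff_def intro: less_imp_le)
        finally show ?thesis .
      qed
      then show "\<forall>\<^sub>F n in sequentially. pairing w (\<lambda>t. (u m t - u n t)\<^sup>2) \<le> e\<^sup>2"
        by (auto simp: eventually_sequentially)
    qed
    then show ?thesis using tnorm_leI[of _ e] \<open>0 < e\<close> by (intro exI[of _ M]) auto
  qed
  obtain M where "(\<lambda>t. u M t - l t) \<in> tsirelson" using close[of 1] by auto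
  \<comment> \<open>\<open>l = u M - (u M - l)\<close>, a difference of two members.\<close>
  from tsirelson_diff[OF u[rule_format, of M] this] have "l \<in> tsirelson" by simp
  moreover have "(\<lambda>n. tnorm (u n - l)) \<longlonglongrightarrow> 0"
  proof (rule metric_LIMSEQ_I)
    fix e :: real assume "0 < e"
    then obtain M where M: "\<forall>m\<ge>M. (\<lambda>t. u m t - l t) \<in> tsirelson \<and> tnorm (\<lambda>t. u m t - l t) \<le> e / 2"
      using close[of "e / 2"] by auto
    have "dist (tnorm (u n - l)) 0 < e" if "n \<ge> M" for n
    proof -
      have "tnorm (\<lambda>t. u n t - l t) \<le> e / 2" "0 \<le> tnorm (\<lambda>t. u n t - l t)"
        using M that tnorm_nonneg by auto
      then show ?thesis using \<open>0 < e\<close> by (simp add: fun_diff_def)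
    qed
    then show "\<exists>M. \<forall>n\<ge>M. dist (tnorm (u n - l)) 0 < e" by blast
  qed
  ultimately show "\<exists>l\<in>tsirelson. (\<lambda>n. tnorm (u n - l)) \<longlonglongrightarrow> 0" by blast
qed

lemma unit_vec_tsirelson: "unit_vec i \<in> tsirelson" and tnorm_unit_vec: "tnorm (unit_vec i) = 1"
proof -
  have 1: "pairing w (\<lambda>t. (unit_vec i t)\<^sup>2) \<le> 1\<^sup>2" if w: "w \<in> norming" for w
  proof -
    have "pairing w (\<lambda>t. (unit_vec i t)\<^sup>2) = (\<Sum>t | w t \<noteq> 0. if t = i then w i else 0)"
      by (auto simp: pairing_def unit_vec_def intro!: sum.cong)
    also have "\<dots> \<le> 1" using norming_finite[OF w] norming_le_1[OF w] by simp
    finally show ?thesis by simp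
  qed
  show 2: "unit_vec i \<in> tsirelson" using tnorm_leI(1)[OF 1] by simp
  have "tnorm (unit_vec i) \<le> 1" using tnorm_leI(2)[OF 1] by simp
  moreover have "1 \<le> tnorm (unit_vec i)" using coord_le_tnorm[OF 2, of i] by (simp add: unit_vec_def)
  ultimately show "tnorm (unit_vec i) = 1" by simp
qed

subsection \<open>Disjoint vectors\<close>

lemma restrict_tsirelson:
  assumes "x \<in> tsirelson"
  shows "(\<lambda>t. if P t then x t else 0) \<in> tsirelson" "tnorm (\<lambda>t. if P t then x t else 0) \<le> tnorm x"
  using tnorm_mono[OF assms, of "\<lambda>t. if P t then x t else 0" 1] by auto

text \<open>The square of \<open>y\<close> is the sum of the squares of its pieces, and a functional
  is additive on them. Hence the upper 2-estimate has constant 1, wherever the pieces lie.\<close>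

lemma tnorm_disjoint_upper:
  assumes "finite J" and y: "\<And>s. s \<in> J \<Longrightarrow> (\<lambda>t. if \<kappa> t = s then y t else 0) \<in> tsirelson"
    and J: "\<And>t. y t \<noteq> 0 \<Longrightarrow> \<kappa> t \<in> J"
  shows "y \<in> tsirelson"
    "(tnorm y)\<^sup>2 \<le> (\<Sum>s\<in>J. (tnorm (\<lambda>t. if \<kappa> t = s then y t else 0))\<^sup>2)"
proof -
  have "pairing w (\<lambda>t. (y t)\<^sup>2) \<le> (\<Sum>s\<in>J. (tnorm (\<lambda>t. if \<kappa> t = s then y t else 0))\<^sup>2)"
    if w: "w \<in> norming" for w
  proof -
    have "(y t)\<^sup>2 = (\<Sum>s\<in>J. (if \<kappa> t = s then y t else 0)\<^sup>2)" for t
    proof (cases "y t = 0")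
      case True
      then have "(if \<kappa> t = s then y t else 0) = 0" for s by simp
      then show ?thesis using True by simp
    next
      case False
      have "(\<Sum>s\<in>J. (if \<kappa> t = s then y t else 0)\<^sup>2) = (\<Sum>s\<in>J. if \<kappa> t = s then (y t)\<^sup>2 else 0)"
        by (intro sum.cong) auto
      then show ?thesis using J[OF False] \<open>finite J\<close> by simp
    qed
    then have "pairing w (\<lambda>t. (y t)\<^sup>2)
        = (\<Sum>t | w t \<noteq> 0. \<Sum>s\<in>J. w t * (if \<kappa> t = s then y t else 0)\<^sup>2)"
      by (simp add: pairing_def sum_distrib_left)
    also have "\<dots> = (\<Sum>s\<in>J. pairing w (\<lambda>t. (if \<kappa> t = s then y t else 0)\<^sup>2))"
      unfolding pairing_def by (rule sum.swap)
    also have "\<dots> \<le> (\<Sum>s\<in>J. (tnorm (\<lambda>t. if \<kappa> t = s then y t else 0))\<^sup>2)"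
      by (intro sum_mono tnorm_upper y w)
    finally show ?thesis .
  qed
  from tnorm_square_leI[OF this] show "y \<in> tsirelson"
    "(tnorm y)\<^sup>2 \<le> (\<Sum>s\<in>J. (tnorm (\<lambda>t. if \<kappa> t = s then y t else 0))\<^sup>2)"
    by (simp_all add: sum_nonneg)
qed

lemma tnorm_almost_attained:
  assumes "x \<in> tsirelson" "0 < e"
  shows "\<exists>w\<in>norming. (tnorm x)\<^sup>2 - e \<le> pairing w (\<lambda>t. (x t)\<^sup>2)"
proof (rule ccontr)
  assume "\<not> ?thesis"
  then have *: "\<And>w. w \<in> norming \<Longrightarrow> pairing w (\<lambda>t. (x t)\<^sup>2) \<le> (tnorm x)\<^sup>2 - e" by (auto simp: not_le less_imp_le)
  have "0 \<le> (tnorm x)\<^sup>2 - e"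
    using *[OF zero_norming] by (simp add: pairing_def)
  from tnorm_square_leI(2)[OF * this] \<open>0 < e\<close> show False by simp
qed

text \<open>Almost norming functionals of the pieces are combined in one tree node; its factor
  \<open>1 / 2\<close> is the constant 2 here. With the upper estimate, at most \<open>adm m\<close>
  disjoint vectors beyond \<open>m\<close> span an almost Euclidean space.\<close>

lemma tnorm_disjoint_lower:
  assumes J: "finite J" "card J \<le> adm m" and y: "y \<in> tsirelson" and m: "\<And>t. t < m \<Longrightarrow> y t = 0"
  shows "(\<Sum>s\<in>J. (tnorm (\<lambda>t. if \<kappa> t = s then y t else 0))\<^sup>2) \<le> 2 * (tnorm y)\<^sup>2"
proof (rule field_le_epsilon)
  fix e :: real assume "0 < e"
  \<comment> \<open>The error \<open>e\<close> is shared among the pieces; the extra 1 keeps the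
    denominator positive when \<open>J\<close> is empty.\<close>
  define \<eta> where "\<eta> = e / (card J + 1)"
  have "0 < \<eta>" using \<open>0 < e\<close> by (simp add: \<eta>_def)
  let ?y = "\<lambda>s t. if \<kappa> t = s then y t else 0"
  have ys: "?y s \<in> tsirelson" for s by (intro restrict_tsirelson y)
  have "\<forall>s. \<exists>w. w \<in> norming \<and> (tnorm (?y s))\<^sup>2 - \<eta> \<le> pairing w (\<lambda>t. (?y s t)\<^sup>2)"
    using tnorm_almost_attained[OF ys \<open>0 < \<eta>\<close>] by blast
  from choice[OF this] obtain w where w: "\<And>s. w s \<in> norming"
    "\<And>s. (tnorm (?y s))\<^sup>2 - \<eta> \<le> pairing (w s) (\<lambda>t. (?y s t)\<^sup>2)" by blast
  \<comment> \<open>Cutting down to the class and to coordinates from \<open>m\<close> on makes the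
    family admissible, at no loss since \<open>y\<close> vanishes below \<open>m\<close>.\<close>
  define v where "v s t = (if t \<in> {t. m \<le> t \<and> \<kappa> t = s} then w s t else 0)" for s t
  have v: "v s \<in> norming" for s
    unfolding v_def[abs_def] by (intro norming_restrict w)
  obtain h where h: "bij_betw h {..<card J} J"
    using ex_bij_betw_nat_finite[OF J(1)] by (auto simp: atLeast0LessThan)
  define W where "W = (\<lambda>t. (\<Sum>l<card J. v (h l) t) / 2)"
  have "W \<in> norming"
    unfolding W_def
  proof (rule tree_norming[OF J(2)])
    fix l l' t assume "l < card J" "l' < card J" "l \<noteq> l'"
    then have "h l \<noteq> h l'" using h by (auto simp: bij_betw_def inj_on_def)
    then show "v (h l) t = 0 \<or> v (h l') t = 0" by (auto simp: v_def)
  qed (auto simp: v, auto simp: v_def)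
  have W_eq: "W t = (\<Sum>s\<in>J. v s t) / 2" for t
    using sum.reindex_bij_betw[OF h, of "\<lambda>s. v s t"] by (simp add: W_def)
  define B where "B = (\<Union>s\<in>J. {t. v s t \<noteq> 0})"
  have B: "finite B" using J(1) norming_finite[OF v] by (auto simp: B_def)
  have "(\<Sum>s\<in>J. (tnorm (?y s))\<^sup>2) - e \<le> (\<Sum>s\<in>J. (tnorm (?y s))\<^sup>2 - \<eta>)"
  proof -
    have "card J * \<eta> \<le> e" using \<open>0 < e\<close> by (simp add: \<eta>_def field_simps)
    then show ?thesis by (simp add: sum_subtractf)
  qed
  also have "\<dots> \<le> (\<Sum>s\<in>J. pairing (v s) (\<lambda>t. (y t)\<^sup>2))"
  proof (rule sum_mono)
    fix s
    have "pairing (v s) (\<lambda>t. (y t)\<^sup>2)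
        = pairing (w s) (\<lambda>t. if t \<in> {t. m \<le> t \<and> \<kappa> t = s} then (y t)\<^sup>2 else 0)"
      unfolding v_def[abs_def] by (rule pairing_restrict[OF w(1)])
    also have "(\<lambda>t. if t \<in> {t. m \<le> t \<and> \<kappa> t = s} then (y t)\<^sup>2 else 0) = (\<lambda>t. (?y s t)\<^sup>2)"
    proof
      fix t show "(if t \<in> {t. m \<le> t \<and> \<kappa> t = s} then (y t)\<^sup>2 else 0) = (?y s t)\<^sup>2"
        using m[of t] by (cases "t < m") auto
    qed
    finally show "(tnorm (?y s))\<^sup>2 - \<eta> \<le> pairing (v s) (\<lambda>t. (y t)\<^sup>2)" using w(2)[of s] by simp
  qed
  also have "\<dots> = (\<Sum>s\<in>J. \<Sum>t\<in>B. v s t * (y t)\<^sup>2)"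
    by (intro sum.cong pairing_eq[OF B]) (auto simp: B_def)
  also have "\<dots> = (\<Sum>t\<in>B. \<Sum>s\<in>J. v s t * (y t)\<^sup>2)" by (rule sum.swap)
  also have "\<dots> = 2 * (\<Sum>t\<in>B. W t * (y t)\<^sup>2)"
    unfolding sum_distrib_left by (intro sum.cong refl) (simp add: W_eq flip: sum_distrib_right)
  also have "\<dots> = 2 * pairing W (\<lambda>t. (y t)\<^sup>2)"
    by (subst pairing_eq[OF B]) (auto simp: W_eq B_def)
  also have "\<dots> \<le> 2 * (tnorm y)\<^sup>2"
    using tnorm_upper[OF y \<open>W \<in> norming\<close>] by simp
  finally show "(\<Sum>s\<in>J. (tnorm (?y s))\<^sup>2) \<le> 2 * (tnorm y)\<^sup>2 + e" by simp
qed

subsection \<open>Schreier families and spread-out measures\<close>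

text \<open>Schreier-type families in which \<open>adm m\<close> sets beyond \<open>m\<close> may be
  united, mirroring the nodes of \<open>norming\<close>. Exactly \<open>adm m\<close> sets are
  listed, so shorter unions are padded with empty sets.\<close>

primrec schreier :: "nat \<Rightarrow> nat set \<Rightarrow> bool" where
  "schreier 0 E \<longleftrightarrow> (\<exists>i. E \<subseteq> {i})"
| "schreier (Suc j) E \<longleftrightarrow>
    (\<exists>m F. E = (\<Union>l<adm m. F l) \<and> (\<forall>l<adm m. schreier j (F l) \<and> F l \<subseteq> {m..}))"

lemma schreier_empty: "schreier j {}"
proof (induction j)
  case (Suc j)
  then show ?case by (auto intro!: exI[of _ "\<lambda>_. {}"])
qed simp

lemma schreier_finite: "schreier j E \<Longrightarrow> finite E"
  by (induction j arbitrary: E) (auto intro: finite_subset)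

lemma schreier_singleton: "schreier j {i}"
proof (induction j)
  case (Suc j)
  show ?case
    unfolding schreier.simps
  proof (intro exI[of _ i] exI[of _ "\<lambda>l. if l = 0 then {i} else {}"] conjI allI impI)
    show "{i} = (\<Union>l<adm i. if l = 0 then {i} else {})" using adm_ge_2[of i] by auto
  qed (simp_all add: Suc schreier_empty)
qed simp

lemma schreier_subset: "schreier j E \<Longrightarrow> E' \<subseteq> E \<Longrightarrow> schreier j E'"
proof (induction j arbitrary: E E')
  case (Suc j)
  then obtain m F where F: "E = (\<Union>l<adm m. F l)" "\<And>l. l < adm m \<Longrightarrow> schreier j (F l) \<and> F l \<subseteq> {m..}"
    by auto
  have "E' = (\<Union>l<adm m. F l \<inter> E')" using F(1) Suc.prems(2) by auto
  moreover have "schreier j (F l \<inter> E') \<and> F l \<inter> E' \<subseteq> {m..}" if "l < adm m" for l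
    using Suc.IH[of "F l" "F l \<inter> E'"] F(2)[OF that] by auto
  ultimately show ?case
    unfolding schreier.simps by (intro exI[of _ m] exI[of _ "\<lambda>l. F l \<inter> E'"]) auto
qed auto

text \<open>The values of a norming functional are \<open>2\<^sup>-\<^sup>d\<close>, where \<open>d\<close> is the depth of the leaf in the tree
  that builds the functional; the leaves of depth at most \<open>j\<close> form a \<open>j\<close>-th Schreier set.\<close>

lemma norming_le_off_schreier:
  assumes "w \<in> norming"
  shows "\<exists>E. schreier j E \<and> (\<forall>t. t \<notin> E \<longrightarrow> w t \<le> (1 / 2) ^ Suc j)"
  using assms
proof (induction arbitrary: j)
  case (unit_norming i)
  show ?case by (rule exI[of _ "{i}"]) (auto simp: schreier_singleton unit_vec_def)
next
  case (tree_norming L m w)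
  have disj: "w l t = 0 \<or> w l' t = 0" if "l < L" "l' < L" "l \<noteq> l'" for l l' t
    using tree_norming that by blast
  show ?case
  proof (cases j)
    case 0
    \<comment> \<open>At level 0 the exceptional set can be empty, because a node has values at most
      \<open>1 / 2\<close>.\<close>
    have "(\<Sum>l<L. w l t) / 2 \<le> 1 / 2" for t
    proof (rule disjoint_sum_cases[of L w t, OF disj])
      fix l assume "l < L" "(\<Sum>l<L. w l t) = w l t"
      then show ?thesis using norming_le_1[of "w l" t] tree_norming by simp
    qed auto
    then show ?thesis using 0 schreier_empty[of 0] by (intro exI[of _ "{}"]) simp
  next
    case (Suc j')
    have "\<forall>l. \<exists>E. l < L \<longrightarrow> schreier j' E \<and> (\<forall>t. t \<notin> E \<longrightarrow> w l t \<le> (1 / 2) ^ Suc j')"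
      using tree_norming by blast
    from choice[OF this] obtain E where
      E: "\<And>l. l < L \<Longrightarrow> schreier j' (E l)" "\<And>l t. l < L \<Longrightarrow> t \<notin> E l \<Longrightarrow> w l t \<le> (1 / 2) ^ Suc j'"
      by blast
    \<comment> \<open>Points below \<open>m\<close> can be removed from \<open>E l\<close> because
      \<open>w l\<close> vanishes there; the empty sets pad the union to \<open>adm m\<close>
      members.\<close>
    define F where "F l = (if l < L then E l \<inter> {m..} else {})" for l
    have "schreier j (\<Union>l<adm m. F l)"
      unfolding Suc schreier.simps
    proof (intro exI[of _ m] exI[of _ F] conjI allI impI refl)
      fix l
      show "schreier j' (F l)"
        using E(1)[of l] schreier_subset[of j' "E l" "F l"] schreier_empty by (auto simp: F_def)
      show "F l \<subseteq> {m..}" by (auto simp: F_def)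
    qed
    moreover have "(\<Sum>l<L. w l t) / 2 \<le> (1 / 2) ^ Suc j" if t: "t \<notin> (\<Union>l<adm m. F l)" for t
    proof (rule disjoint_sum_cases[of L w t, OF disj])
      fix l assume l: "l < L" "(\<Sum>l<L. w l t) = w l t"
      have "t < m \<or> t \<notin> E l" using t l(1) tree_norming(1) by (auto simp: F_def split: if_splits)
      then have "w l t \<le> (1 / 2) ^ Suc j'" using E(2)[OF l(1)] tree_norming l(1) by auto
      then show ?thesis using l(2) Suc by simp
    qed auto
    ultimately show ?thesis by blast
  qed
qed

text \<open>On the exceptional set of \<open>w\<close> the bound \<open>w t \<le> 1\<close> leaves
  mass at most \<open>\<delta>\<close>; off it \<open>w\<close> is at most
  \<open>(1 / 2) ^ Suc j\<close> and the total mass is 1.\<close>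

lemma pairing_le_schreier:
  assumes w: "w \<in> norming" and a: "\<And>t. 0 \<le> a t" "\<And>t. B \<le> t \<Longrightarrow> a t = 0" "sum a {..<B} = 1"
    and E: "\<And>E. schreier j E \<Longrightarrow> sum a E \<le> \<delta>"
  shows "pairing w a \<le> \<delta> + (1 / 2) ^ Suc j"
proof -
  obtain E where E': "schreier j E" "\<And>t. t \<notin> E \<Longrightarrow> w t \<le> (1 / 2) ^ Suc j"
    using norming_le_off_schreier[OF w, of j] by blast
  define S where "S = {t. w t \<noteq> 0} \<union> {..<B} \<union> E"
  have S: "finite S" using norming_finite[OF w] schreier_finite[OF E'(1)] by (simp add: S_def)
  have "pairing w a = (\<Sum>t\<in>S. w t * a t)" by (rule pairing_eq[OF S]) (auto simp: S_def)
  also have "\<dots> \<le> (\<Sum>t\<in>S. (if t \<in> E then a t else 0) + (1 / 2) ^ Suc j * a t)"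
  proof (rule sum_mono)
    fix t
    show "w t * a t \<le> (if t \<in> E then a t else 0) + (1 / 2) ^ Suc j * a t"
    proof (cases "t \<in> E")
      case True
      have "w t * a t \<le> 1 * a t" by (intro mult_right_mono norming_le_1 w a)
      moreover have "0 \<le> (1 / 2) ^ Suc j * a t" using a by simp
      ultimately show ?thesis using True by simp
    next
      case False
      have "w t * a t \<le> (1 / 2) ^ Suc j * a t" by (rule mult_right_mono[OF E'(2)[OF False] a(1)])
      then show ?thesis using False by simp
    qed
  qed
  also have "\<dots> = (\<Sum>t\<in>S. if t \<in> E then a t else 0) + (1 / 2) ^ Suc j * sum a S"
    unfolding sum.distrib sum_distrib_left ..
  also have "(\<Sum>t\<in>S. if t \<in> E then a t else 0) = sum a E"
    using S by (subst sum.inter_restrict[symmetric]) (auto simp: S_def Int_absorb1 intro!: sum.cong)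
  also have "sum a S = sum a {..<B}"
    using a(2) S by (intro sum.mono_neutral_right) (auto simp: S_def)
  finally show ?thesis using E[OF E'(1)] a(3) by simp
qed

text \<open>The intervals from \<open>P s\<close> to \<open>P (Suc s)\<close> are disjoint. The
  first one is extended down to 0, so that it is the block charged for every \<open>m\<close> before
  \<open>P 0\<close>.\<close>

lemma disjoint_blocks:
  fixes P :: "nat \<Rightarrow> nat"
  assumes "strict_mono P"
  shows "card {s. s < r \<and> (s = 0 \<or> P s \<le> m) \<and> m < P (Suc s)} \<le> 1"
proof -
  have "s = s'" if "(s = 0 \<or> P s \<le> m) \<and> m < P (Suc s)" "(s' = 0 \<or> P s' \<le> m) \<and> m < P (Suc s')" for s s'
  proof (rule ccontr)
    assume "s \<noteq> s'"
    then have "Suc s \<le> s' \<or> Suc s' \<le> s" by auto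
    then have "P (Suc s) \<le> P s' \<and> s' \<noteq> 0 \<or> P (Suc s') \<le> P s \<and> s \<noteq> 0"
      using assms by (auto simp: strict_mono_less_eq)
    then show False using that by auto
  qed
  then show ?thesis by (auto simp: card_le_Suc0_iff_eq)
qed

lemma sum_UN_le:
  fixes a :: "'b \<Rightarrow> real" and F :: "nat \<Rightarrow> 'b set"
  assumes "\<And>l. l < n \<Longrightarrow> finite (F l)" "\<And>t. 0 \<le> a t"
  shows "sum a (\<Union>l<n. F l) \<le> (\<Sum>l<n. sum a (F l))"
  using assms(1)
proof (induction n)
  case (Suc n)
  have "sum a (\<Union>l<Suc n. F l) = sum a (F n \<union> (\<Union>l<n. F l))" by (simp add: lessThan_Suc)
  also have "\<dots> \<le> sum a (F n) + sum a (\<Union>l<n. F l)"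
  proof -
    have "sum a (F n \<union> (\<Union>l<n. F l)) + sum a (F n \<inter> (\<Union>l<n. F l)) = sum a (F n) + sum a (\<Union>l<n. F l)"
      using Suc.prems by (intro sum.union_inter) auto
    moreover have "0 \<le> sum a (F n \<inter> (\<Union>l<n. F l))" using assms(2) by (intro sum_nonneg) auto
    ultimately show ?thesis by linarith
  qed
  also have "\<dots> \<le> (\<Sum>l<Suc n. sum a (F l))" using Suc by simp
  finally show ?case .
qed simp

lemma four_M_adm_le:
  assumes "2 \<le> M" shows "4 * M * adm M \<le> ackermann_g (3 + i) M"
  unfolding adm_def
  by (rule order_trans[OF double_exp_le_ackermann_g_3[OF assms] ackermann_g_le_add[OF assms]])

text \<open>In the step, \<open>r\<close> successive measures of the previous level are averaged. Only one of their
  supports can contain the parameter \<open>m\<close> of a Schreier set of the next level; earlier ones do not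
  meet the set, and on a later one, starting at \<open>M'\<close>, the set is a union of at most
  \<open>adm m \<le> adm M'\<close> sets of the previous level.\<close>

lemma spread_measure_exists:
  assumes "2 \<le> M"
  shows "\<exists>a :: nat \<Rightarrow> real. (\<forall>t. 0 \<le> a t) \<and>
    (\<forall>t. a t \<noteq> 0 \<longrightarrow> M \<le> t \<and> t < ackermann_g (3 + 2 * j) M) \<and>
    sum a {..<ackermann_g (3 + 2 * j) M} = 1 \<and>
    (\<forall>E. schreier j E \<longrightarrow> sum a E \<le> 1 / (2 * M * adm M))"
  using assms
proof (induction j arbitrary: M)
  case 0
  \<comment> \<open>The uniform measure on the \<open>n\<close> points from \<open>M\<close> on;
    \<open>n\<close> is the reciprocal of the required bound on a singleton.\<close>
  define n where "n = 2 * M * adm M"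
  have n: "0 < n" using 0 adm_ge_2[of M] by (simp add: n_def)
  have "M \<le> n" using adm_ge_2[of M] by (simp add: n_def)
  moreover have "4 * M * adm M = n + n" by (simp add: n_def)
  then have "n + n \<le> ackermann_g 3 M" using four_M_adm_le[OF 0, of 0] by (simp only: add_0_right)
  ultimately have le: "M + n \<le> ackermann_g 3 M" by linarith
  define a :: "nat \<Rightarrow> real" where "a t = (if t \<in> {M..<M + n} then 1 / n else 0)" for t
  have "sum a {..<ackermann_g 3 M} = sum a {M..<M + n}"
    using le by (intro sum.mono_neutral_right) (auto simp: a_def)
  also have "\<dots> = 1" using n by (simp add: a_def)
  finally have "sum a {..<ackermann_g 3 M} = 1" .
  moreover have "sum a E \<le> 1 / n" if "E \<subseteq> {i}" for E i
  proof -
    have "sum a E \<le> sum a {i}" using that by (intro sum_mono2) (auto simp: a_def)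
    also have "\<dots> \<le> 1 / n" by (simp add: a_def)
    finally show ?thesis .
  qed
  ultimately show ?case
    using le by (intro exI[of _ a]) (auto simp: a_def n_def simp del: ackermann_g.simps)
next
  case (Suc j)
  define U where "U = ackermann_g (3 + 2 * j)"
  define \<delta> :: "nat \<Rightarrow> real" where "\<delta> M' = 1 / (2 * M' * adm M')" for M'
  have "\<forall>M'. \<exists>a :: nat \<Rightarrow> real. 2 \<le> M' \<longrightarrow> (\<forall>t. 0 \<le> a t) \<and> (\<forall>t. a t \<noteq> 0 \<longrightarrow> M' \<le> t \<and> t < U M') \<and>
    sum a {..<U M'} = 1 \<and> (\<forall>E. schreier j E \<longrightarrow> sum a E \<le> \<delta> M')"
    using Suc.IH unfolding U_def \<delta>_def by blast
  from choice[OF this] obtain b :: "nat \<Rightarrow> nat \<Rightarrow> real" where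
    b: "\<And>M' t. 2 \<le> M' \<Longrightarrow> 0 \<le> b M' t" "\<And>M' t. 2 \<le> M' \<Longrightarrow> b M' t \<noteq> 0 \<Longrightarrow> M' \<le> t \<and> t < U M'"
      "\<And>M'. 2 \<le> M' \<Longrightarrow> sum (b M') {..<U M'} = 1"
      "\<And>M' E. 2 \<le> M' \<Longrightarrow> schreier j E \<Longrightarrow> sum (b M') E \<le> \<delta> M'" by blast
  \<comment> \<open>\<open>P s\<close> is the start of block \<open>s\<close>: the measure
    \<open>b (P s)\<close> lives between \<open>P s\<close> and \<open>P (Suc s)\<close>.\<close>
  define P where "P s = (U ^^ s) M" for s
  have P_Suc: "P (Suc s) = U (P s)" for s by (simp add: P_def)
  have P2: "2 \<le> P s" for s
  proof (induction s)
    case (Suc s)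
    then show ?case using ackermann_g_gt[of "P s" "3 + 2 * j"] unfolding P_Suc U_def by linarith
  qed (simp add: P_def Suc.prems)
  have "P s < P (Suc s)" for s
    using ackermann_g_gt[of "P s" "3 + 2 * j"] P2[of s] unfolding P_Suc U_def by linarith
  then have P_mono: "strict_mono P" by (simp add: strict_mono_Suc_iff)
  \<comment> \<open>Here \<open>r * \<delta> M = 2\<close>. After averaging, the one exceptional
    block costs \<open>1 / r = \<delta> M / 2\<close>, and the other blocks together at most
    \<open>\<delta> M / 2\<close>.\<close>
  define r where "r = 4 * M * adm M"
  have r: "0 < r" using Suc.prems adm_ge_2[of M] by (simp add: r_def)
  define G where "G = ackermann_g (3 + 2 * Suc j) M"
  \<comment> \<open>The \<open>r\<close> iterations of \<open>U\<close> from
    \<open>M \<le> r\<close> form one application of the next level to \<open>r\<close>, and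
    \<open>r\<close> is itself bounded by that level at \<open>M\<close>. The composition costs one
    more level, hence two levels per step of \<open>j\<close>.\<close>
  have "P r \<le> G"
  proof -
    have "M \<le> r" using adm_ge_2[of M] by (simp add: r_def)
    then have "P r \<le> (U ^^ r) r"
      unfolding P_def U_def by (intro funpow_mono_le[where a = 0]) (auto simp: ackermann_g_props)
    also have "\<dots> = ackermann_g (Suc (3 + 2 * j)) r" by (simp only: U_def ackermann_g.simps)
    also have "\<dots> \<le> ackermann_g (Suc (3 + 2 * j)) (ackermann_g (3 + Suc (2 * j)) M)"
      unfolding r_def by (intro monoD[OF ackermann_g_mono] four_M_adm_le Suc.prems)
    also have "\<dots> \<le> ackermann_g (Suc (Suc (3 + 2 * j))) M"
      using ackermann_g_twice_le[OF Suc.prems, of "Suc (3 + 2 * j)"]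
      by (simp del: ackermann_g.simps)
    also have "\<dots> = G" by (simp add: G_def del: ackermann_g.simps)
    finally show ?thesis .
  qed
  have PG: "P (Suc s) \<le> G" if "s < r" for s
    using that P_mono \<open>P r \<le> G\<close> by (auto simp: Suc_le_eq intro: order_trans[of _ "P r"] simp: strict_mono_less_eq)
  define a where "a t = (\<Sum>s<r. b (P s) t) / r" for t
  have sum_a: "sum a E = (\<Sum>s<r. sum (b (P s)) E) / r" for E
    unfolding a_def sum_divide_distrib[symmetric] by (subst sum.swap) simp
  have "sum (b (P s)) {..<G} = 1" if "s < r" for s
  proof -
    have "sum (b (P s)) {..<G} = sum (b (P s)) {..<U (P s)}"
      using PG[OF that] b(2)[OF P2] by (intro sum.mono_neutral_right) (force simp: P_Suc)+
    then show ?thesis using b(3)[OF P2] by simp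
  qed
  then have "sum a {..<G} = 1" using r by (simp add: sum_a)
  moreover have "0 \<le> a t" for t using b(1)[OF P2] by (auto simp: a_def intro!: sum_nonneg divide_nonneg_nonneg)
  moreover have "M \<le> t \<and> t < G" if "a t \<noteq> 0" for t
  proof -
    have "(\<Sum>s<r. b (P s) t) \<noteq> 0" using that by (auto simp: a_def)
    then obtain s where s: "s \<in> {..<r}" "b (P s) t \<noteq> 0"
      using sum.not_neutral_contains_not_neutral by blast
    have "M = P 0" by (simp add: P_def)
    then have "M \<le> P s" using P_mono by (simp add: strict_mono_less_eq)
    then show ?thesis using b(2)[OF P2 s(2)] PG[of s] s(1) by (auto simp: P_Suc)
  qed
  moreover have "sum a E \<le> \<delta> M" if E_schreier: "schreier (Suc j) E" for E
  proof -
    obtain m F where E: "E = (\<Union>l<adm m. F l)"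
      and F: "\<And>l. l < adm m \<Longrightarrow> schreier j (F l)" "\<And>l. l < adm m \<Longrightarrow> F l \<subseteq> {m..}"
      using E_schreier by auto
    define X where "X = {s. s < r \<and> (s = 0 \<or> P s \<le> m) \<and> m < P (Suc s)}"
    have "sum (b (P s)) E \<le> (if s \<in> X then 1 else 0) + \<delta> M / 2" if s_r: "s < r" for s
    proof -
      have fin: "finite E" using schreier_finite E_schreier by blast
      have \<delta>0: "0 \<le> \<delta> M" by (simp add: \<delta>_def)
      have "s \<in> X \<or> P (Suc s) \<le> m \<or> 0 < s \<and> m < P s"
        using s_r by (simp add: X_def) linarith
      then consider "s \<in> X" | "P (Suc s) \<le> m" | "0 < s" "m < P s" by blast
      then show ?thesis
      proof cases
        case 1
        have "sum (b (P s)) E \<le> sum (b (P s)) (E \<union> {..<U (P s)})"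
          using fin b(1)[OF P2] by (intro sum_mono2) auto
        also have "\<dots> = sum (b (P s)) {..<U (P s)}"
          using fin b(2)[OF P2] by (intro sum.mono_neutral_right) auto
        finally show ?thesis using 1 b(3)[OF P2, of s] \<delta>0 by simp
      next
        case 2
        have "b (P s) t = 0" if t_E: "t \<in> E" for t
        proof (rule ccontr)
          assume "b (P s) t \<noteq> 0"
          from b(2)[OF P2 this] have "t < m" using 2 by (simp add: P_Suc)
          moreover obtain l where "l < adm m" "t \<in> F l" using t_E by (auto simp: E)
          ultimately show False using F(2)[of l] by auto
        qed
        then have "sum (b (P s)) E = 0" by simp
        then show ?thesis using \<delta>0 by simp
      next
        case 3
        have "sum (b (P s)) E \<le> (\<Sum>l<adm m. sum (b (P s)) (F l))"
          unfolding E using F(1) schreier_finite b(1)[OF P2] by (intro sum_UN_le) auto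
        also have "\<dots> \<le> (\<Sum>l<adm m. \<delta> (P s))"
          using b(4)[OF P2] F(1) by (intro sum_mono) auto
        also have "\<dots> = adm m * \<delta> (P s)" by simp
        also have "\<dots> \<le> adm (P s) * \<delta> (P s)"
          by (rule mult_right_mono) (use adm_mono[of m "P s"] 3 in \<open>simp_all add: \<delta>_def\<close>)
        also have "\<dots> = 1 / (2 * P s)" using adm_ge_2[of "P s"] by (simp add: \<delta>_def)
        \<comment> \<open>Here \<open>0 < s\<close> matters: it gives
          \<open>P s \<ge> P 1 \<ge> 4 * M * adm M\<close>. This is why block 0 belongs to
          \<open>X\<close> even if \<open>m\<close> lies before it.\<close>
        also have "\<dots> \<le> \<delta> M / 2"
        proof -
          have "4 * M * adm M \<le> P 1"
            using four_M_adm_le[OF Suc.prems] by (simp add: P_def U_def del: ackermann_g.simps)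
          also have "\<dots> \<le> P s" using P_mono 3 by (simp add: strict_mono_less_eq)
          finally have "4 * M * adm M \<le> 2 * P s" by simp
          then have "real (4 * M * adm M) \<le> real (2 * P s)" by (rule of_nat_mono)
          moreover have "0 < 4 * M * adm M" using r by (simp add: r_def)
          ultimately have "1 / real (2 * P s) \<le> 1 / real (4 * M * adm M)"
            by (intro frac_le) simp_all
          then show ?thesis by (simp add: \<delta>_def)
        qed
        finally show ?thesis by simp
      qed
    qed
    then have "(\<Sum>s<r. sum (b (P s)) E) \<le> (\<Sum>s<r. (if s \<in> X then 1 else 0) + \<delta> M / 2)"
      by (intro sum_mono) auto
    also have "\<dots> = card X + r * (\<delta> M / 2)"
    proof -
      have "X = {s \<in> {..<r}. s \<in> X}" by (auto simp: X_def)
      then have "(\<Sum>s<r. if s \<in> X then 1 else 0 :: real) = card X"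
        by (simp flip: sum.inter_filter)
      then show ?thesis by (simp add: sum.distrib)
    qed
    also have "\<dots> \<le> 1 + r * (\<delta> M / 2)"
      using disjoint_blocks[OF P_mono, of r m] by (simp add: X_def)
    also have "\<dots> = r * \<delta> M" using r by (simp add: r_def \<delta>_def field_simps)
    finally show ?thesis using r by (simp add: sum_a field_simps)
  qed
  ultimately show ?case unfolding G_def \<delta>_def by (intro exI[of _ a]) blast
qed

subsection \<open>Euclidean distortion of the span of the first unit vectors\<close>

lemma sum_fun_apply: "(\<Sum>i\<in>A. f i) t = (\<Sum>i\<in>A. f i t :: 'b :: comm_monoid_add)"
  by (induction A rule: infinite_finite_induct) auto

lemma inj_unit_vec: "inj unit_vec"
proof (rule injI)
  fix i j assume "unit_vec i = unit_vec j"
  from fun_cong[OF this, of i] show "i = j" by (simp add: unit_vec_def split: if_splits)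
qed

lemma unit_vec_sum: "(\<Sum>i<n. c i *\<^sub>R unit_vec i) t = (if t < n then c t else 0)"
  by (simp add: sum_fun_apply scaleR_fun_def unit_vec_def if_distrib cong: if_cong)

lemma dim_unit_vecs: "dim (span (unit_vec ` {..<n})) = n"
proof -
  have inj: "inj_on unit_vec {..<n}" using inj_unit_vec inj_on_subset by blast
  have "independent (unit_vec ` {..<n})"
  proof
    assume "dependent (unit_vec ` {..<n})"
    then obtain u i where i: "i < n" "u (unit_vec i) \<noteq> 0"
      and u: "(\<Sum>v\<in>unit_vec ` {..<n}. u v *\<^sub>R v) = 0"
      by (subst (asm) dependent_finite) auto
    have "(\<Sum>i<n. u (unit_vec i) *\<^sub>R unit_vec i) = 0"
      using u by (simp add: sum.reindex[OF inj])
    from fun_cong[OF this, of i] unit_vec_sum[of "\<lambda>i. u (unit_vec i)" n i] i show False by simp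
  qed
  then show ?thesis using inj by (simp add: dim_eq_card_independent card_image)
qed

lemma unit_span_tsirelson: "span (unit_vec ` A) \<subseteq> tsirelson"
  by (intro span_minimal tsirelson_subspace) (auto simp: unit_vec_tsirelson)

lemma ell2_norm_square: "f \<in> ell2 \<Longrightarrow> (ell2_norm f)\<^sup>2 = (\<Sum>k. (f k)\<^sup>2)"
  by (auto simp: ell2_norm_def ell2_def intro!: suminf_nonneg)

lemma ell2_parallelogram:
  assumes "f \<in> ell2" "g \<in> ell2" "f + g \<in> ell2" "f + (- 1) *\<^sub>R g \<in> ell2"
  shows "(ell2_norm (f + g))\<^sup>2 + (ell2_norm (f + (- 1) *\<^sub>R g))\<^sup>2 = 2 * (ell2_norm f)\<^sup>2 + 2 * (ell2_norm g)\<^sup>2"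
proof -
  have s: "summable (\<lambda>k. (f k)\<^sup>2)" "summable (\<lambda>k. (g k)\<^sup>2)" "summable (\<lambda>k. ((f + g) k)\<^sup>2)"
    "summable (\<lambda>k. ((f + (- 1) *\<^sub>R g) k)\<^sup>2)"
    using assms by (auto simp: ell2_def)
  have "(\<Sum>k. ((f + g) k)\<^sup>2) + (\<Sum>k. ((f + (- 1) *\<^sub>R g) k)\<^sup>2)
      = (\<Sum>k. ((f + g) k)\<^sup>2 + ((f + (- 1) *\<^sub>R g) k)\<^sup>2)"
    by (intro suminf_add s)
  also have "\<dots> = (\<Sum>k. 2 * (f k)\<^sup>2 + 2 * (g k)\<^sup>2)"
    by (simp add: scaleR_fun_def power2_eq_square algebra_simps)
  also have "\<dots> = (\<Sum>k. 2 * (f k)\<^sup>2) + (\<Sum>k. 2 * (g k)\<^sup>2)"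
    by (intro suminf_add[symmetric] summable_mult s)
  also have "\<dots> = 2 * (\<Sum>k. (f k)\<^sup>2) + 2 * (\<Sum>k. (g k)\<^sup>2)" using s by (simp add: suminf_mult)
  finally show ?thesis using assms by (simp add: ell2_norm_square)
qed

text \<open>The signs of the coordinates of \<open>x\<close> are chosen one at a time so that \<open>\<parallel>T x\<parallel>\<close> is large,
  whereas the norm of \<open>x\<close> does not depend on them.\<close>

lemma distortion_ge:
  assumes a: "\<And>t. 0 \<le> a t" "\<And>t. n \<le> t \<Longrightarrow> a t = 0" "sum a {..<n} = 1"
    and \<eta>: "\<And>w. w \<in> norming \<Longrightarrow> pairing w a \<le> \<eta>" and R: "R\<^sup>2 * \<eta> \<le> 1"
  shows "ereal R \<le> euclidean_distortion (span (unit_vec ` {..<n})) tnorm"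
  unfolding euclidean_distortion_def
proof (rule Inf_greatest, safe)
  let ?F = "span (unit_vec ` {..<n})"
  fix D T assume D: "0 < D" and T: "linear_map_on ?F ell2 T"
    and bounds: "\<forall>x\<in>?F. tnorm x \<le> ell2_norm (T x) \<and> ell2_norm (T x) \<le> D * tnorm x"
  have T_add: "T (x + y) = T x + T y" if "x \<in> ?F" "y \<in> ?F" for x y
    using T that unfolding linear_map_on_def by blast
  have T_scale: "T (r *\<^sub>R x) = r *\<^sub>R T x" if "x \<in> ?F" for r x
    using T that unfolding linear_map_on_def by blast
  have T_ell2: "T x \<in> ell2" if "x \<in> ?F" for x using T that by (auto simp: linear_map_on_def)
  have "\<exists>x\<in>?F. (\<forall>t. (x t)\<^sup>2 = (if t < k then a t else 0)) \<and> sum a {..<k} \<le> (ell2_norm (T x))\<^sup>2"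
    if "k \<le> n" for k
    using that
  proof (induction k)
    case 0
    show ?case by (rule bexI[of _ 0]) (auto simp: span_zero)
  next
    case (Suc k)
    then obtain x where x: "x \<in> ?F" "\<And>t. (x t)\<^sup>2 = (if t < k then a t else 0)"
      "sum a {..<k} \<le> (ell2_norm (T x))\<^sup>2" by auto
    \<comment> \<open>Either sign of \<open>y\<close> makes the square of coordinate
      \<open>k\<close> equal to \<open>a k\<close>.\<close>
    define y where "y = sqrt (a k) *\<^sub>R unit_vec k"
    have e: "unit_vec k \<in> ?F" using Suc.prems by (auto intro: span_base)
    then have y: "y \<in> ?F" by (auto simp: y_def intro: span_scale)
    have xy: "x + y \<in> ?F" "x + (- 1) *\<^sub>R y \<in> ?F" using x(1) y by (auto intro: span_add span_diff)
    have add: "T (x + y) = T x + T y" "T (x + (- 1) *\<^sub>R y) = T x + (- 1) *\<^sub>R T y"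
      using T_add[OF x(1) y] T_add[OF x(1) span_scale[OF y, of "- 1"]] T_scale[OF y, of "- 1"]
      by (simp_all only:)
    have "T y = sqrt (a k) *\<^sub>R T (unit_vec k)" unfolding y_def by (rule T_scale[OF e])
    then have "(ell2_norm (T y))\<^sup>2 = (\<Sum>i. a k * (T (unit_vec k) i)\<^sup>2)"
      using a(1) ell2_norm_square[OF T_ell2[OF y]] by (simp add: scaleR_fun_def power_mult_distrib)
    also have "\<dots> = a k * (ell2_norm (T (unit_vec k)))\<^sup>2"
      unfolding ell2_norm_square[OF T_ell2[OF e]]
      using T_ell2[OF e] by (intro suminf_mult) (auto simp: ell2_def)
    finally have Ty: "(ell2_norm (T y))\<^sup>2 = a k * (ell2_norm (T (unit_vec k)))\<^sup>2" .
    have "1 \<le> ell2_norm (T (unit_vec k))" using bspec[OF bounds e] tnorm_unit_vec[of k] by simp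
    then have "a k * 1 \<le> (ell2_norm (T y))\<^sup>2"
      unfolding Ty by (intro mult_left_mono a one_le_power)
    moreover have "(ell2_norm (T (x + y)))\<^sup>2 + (ell2_norm (T (x + (- 1) *\<^sub>R y)))\<^sup>2
        = 2 * (ell2_norm (T x))\<^sup>2 + 2 * (ell2_norm (T y))\<^sup>2"
      using ell2_parallelogram[OF T_ell2[OF x(1)] T_ell2[OF y]] T_ell2[OF xy(1)] T_ell2[OF xy(2)]
      unfolding add by blast
    \<comment> \<open>By the parallelogram law the two squared norms average at least
      \<open>sum a {..<k} + a k\<close>, so one of the two signs is good.\<close>
    ultimately have "sum a {..<Suc k} \<le> (ell2_norm (T (x + y)))\<^sup>2
        \<or> sum a {..<Suc k} \<le> (ell2_norm (T (x + (- 1) *\<^sub>R y)))\<^sup>2"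
      using x(3) by (simp only: sum.lessThan_Suc) linarith
    moreover have "((x + y) t)\<^sup>2 = (if t < Suc k then a t else 0)
        \<and> ((x + (- 1) *\<^sub>R y) t)\<^sup>2 = (if t < Suc k then a t else 0)" for t
      using x(2)[of t] a(1)[of k] by (auto simp: y_def scaleR_fun_def unit_vec_def split: if_splits)
    ultimately show ?case using xy by blast
  qed
  from this[of n] obtain x where x: "x \<in> ?F" "1 \<le> (ell2_norm (T x))\<^sup>2"
    and sq: "\<And>t. (x t)\<^sup>2 = (if t < n then a t else 0)" using a(3) by auto
  have "(x t)\<^sup>2 = a t" for t using sq[of t] a(2)[of t] by (cases "t < n") auto
  note x = x(1) this x(2)
  have \<eta>0: "0 \<le> \<eta>" using \<eta>[OF zero_norming] by (simp add: pairing_def)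
  have "(tnorm x)\<^sup>2 \<le> \<eta>" using x(2) \<eta> \<eta>0 by (intro tnorm_square_leI(2)) auto
  moreover have "(ell2_norm (T x))\<^sup>2 \<le> (D * tnorm x)\<^sup>2"
    using bspec[OF bounds x(1)] tnorm_nonneg[OF subsetD[OF unit_span_tsirelson x(1)]]
    by (intro power_mono) auto
  \<comment> \<open>The chosen \<open>x\<close> has \<open>1 \<le> \<parallel>T x\<parallel>\<close>
    but squared norm at most \<open>\<eta>\<close>, so \<open>D\<close> satisfies
    \<open>1 \<le> D\<^sup>2 * \<eta>\<close>, while
    \<open>R\<^sup>2 * \<eta> \<le> 1\<close>.\<close>
  ultimately have D1: "1 \<le> D\<^sup>2 * \<eta>"
    using x(3) mult_left_mono[of "(tnorm x)\<^sup>2" \<eta> "D\<^sup>2"] by (simp add: power_mult_distrib)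
  then have "0 < \<eta>" using \<eta>0 by (cases "\<eta> = 0") auto
  then have "R\<^sup>2 \<le> D\<^sup>2" using R D1 by (metis mult_right_le_imp_le order_trans)
  then have "R \<le> D" using D by (auto intro: power2_le_imp_le)
  then show "ereal R \<le> ereal D" by simp
qed

section \<open>Distortion bounds in the three ranges of the inverse Ackermann function\<close>

lemma distortion_ge_ackermann:
  assumes "ackermann_g (4 + 2 * j) 2 \<le> n"
  shows "ereal (2 powr (j / 2)) \<le> euclidean_distortion (span (unit_vec ` {..<n})) tnorm"
proof -
  \<comment> \<open>Starting at \<open>j + 2\<close> rather than 2 brings the Schreier mass below
    \<open>(1 / 2) ^ Suc j\<close>. Since \<open>M\<close> is at most level \<open>3 + 2 * j\<close>
    at 2, the later start costs one level.\<close>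
  define M where "M = j + 2"
  have M: "2 \<le> M" by (simp add: M_def)
  obtain a :: "nat \<Rightarrow> real" where a: "\<And>t. 0 \<le> a t"
    "\<And>t. a t \<noteq> 0 \<Longrightarrow> M \<le> t \<and> t < ackermann_g (3 + 2 * j) M"
    "sum a {..<ackermann_g (3 + 2 * j) M} = 1"
    "\<And>E. schreier j E \<Longrightarrow> sum a E \<le> 1 / (2 * M * adm M)"
    using spread_measure_exists[OF M] by blast
  have "M \<le> ackermann_g (3 + 2 * j) 2" using ackermann_g_2_ge[of "3 + 2 * j"] by (simp add: M_def)
  then have "ackermann_g (3 + 2 * j) M \<le> ackermann_g (3 + 2 * j) (ackermann_g (3 + 2 * j) 2)"
    by (rule monoD[OF ackermann_g_mono])
  also have "\<dots> \<le> ackermann_g (4 + 2 * j) 2"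
    using ackermann_g_twice_le[of 2 "3 + 2 * j"] by (simp del: ackermann_g.simps)
  finally have le: "ackermann_g (3 + 2 * j) M \<le> n" using assms by linarith
  have "sum a {..<n} = sum a {..<ackermann_g (3 + 2 * j) M}"
    using a(2) le by (intro sum.mono_neutral_right) force+
  then have sum1: "sum a {..<n} = 1" using a(3) by simp
  have zero: "a t = 0" if "n \<le> t" for t using a(2)[of t] le that by force
  have "1 / (2 * M * adm M) \<le> (1 / 2) ^ Suc j"
  proof -
    have "Suc j \<le> 2 ^ M" using less_exp[of M] by (simp add: M_def)
    then have "(2::nat) ^ Suc j \<le> adm M" unfolding adm_def by (rule power_increasing) simp
    also have "\<dots> \<le> 2 * M * adm M" using M by simp
    finally have "2 ^ Suc j \<le> real (2 * M * adm M)" by (metis of_nat_le_iff of_nat_numeral of_nat_power)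
    then have "1 / real (2 * M * adm M) \<le> 1 / 2 ^ Suc j" 
      by (intro frac_le) simp_all
    then show ?thesis by (simp add: power_one_over)
  qed
  \<comment> \<open>The mass on the exceptional set and the contribution off it are each at most
    \<open>(1 / 2) ^ Suc j\<close>.\<close>
  then have "pairing w a \<le> (1 / 2) ^ j" if "w \<in> norming" for w
    using pairing_le_schreier[OF that a(1) zero sum1 a(4)] by fastforce
  moreover have "(2 powr (j / 2))\<^sup>2 * (1 / 2) ^ j = (1 :: real)"
    by (simp add: powr_realpow[symmetric] powr_powr power_one_over flip: powr_realpow[of 2])
  ultimately show ?thesis by (intro distortion_ge[OF a(1) zero sum1]) auto
qed

text \<open>Half the mass on each of the first two coordinates: a unit functional sees one of them,
  and a tree functional has values at most \<open>1 / 2\<close>.\<close>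

lemma distortion_ge_sqrt_2:
  assumes "2 \<le> n"
  shows "ereal (sqrt 2) \<le> euclidean_distortion (span (unit_vec ` {..<n})) tnorm"
proof -
  define a :: "nat \<Rightarrow> real" where "a t = (if t < 2 then 1 / 2 else 0)" for t
  have "sum a {..<n} = sum a {..<2}"
    using assms by (intro sum.mono_neutral_right) (auto simp: a_def)
  also have "\<dots> = 1" by (simp add: a_def)
  finally have sum1: "sum a {..<n} = 1" .
  have zero: "a t = 0" if "n \<le> t" for t using that assms by (simp add: a_def)
  have nonneg: "0 \<le> a t" for t by (simp add: a_def)
  have "pairing w a \<le> 1 / 2" if "w \<in> norming" for w
    using that
  proof cases
    case (unit_norming i)
    then show ?thesis by (simp add: pairing_unit_vec a_def)
  next
    case (tree_norming L m w')
    have w: "w t \<le> 1 / 2" for t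
    proof (rule disjoint_sum_cases[of L w' t])
      fix l assume "l < L" "(\<Sum>l<L. w' l t) = w' l t"
      then show ?thesis using tree_norming norming_le_1[of "w' l" t] by simp
    qed (use tree_norming in auto)
    define S where "S = {t. w t \<noteq> 0} \<union> {..<n}"
    have S: "finite S" using norming_finite[OF that] by (simp add: S_def)
    have "pairing w a = (\<Sum>t\<in>S. w t * a t)" by (rule pairing_eq[OF S]) (auto simp: S_def)
    also have "\<dots> \<le> (\<Sum>t\<in>S. 1 / 2 * a t)" by (intro sum_mono mult_right_mono w nonneg)
    also have "\<dots> = 1 / 2 * sum a S" by (rule sum_distrib_left[symmetric])
    also have "sum a S = sum a {..<n}" using zero S by (intro sum.mono_neutral_right) (auto simp: S_def)
    finally show ?thesis using sum1 by simp
  qed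
  then show ?thesis by (intro distortion_ge[OF nonneg zero sum1, of "1 / 2"]) simp_all
qed

lemma distortion_ge_1:
  assumes "1 \<le> n"
  shows "ereal 1 \<le> euclidean_distortion (span (unit_vec ` {..<n})) tnorm"
proof (rule distortion_ge[where a = "unit_vec 0" and \<eta> = 1])
  show "pairing w (unit_vec 0) \<le> 1" if "w \<in> norming" for w
  proof -
    have "pairing w (unit_vec 0) = pairing w (\<lambda>t. (unit_vec 0 t)\<^sup>2)"
      by (rule arg_cong[of _ _ "pairing w"]) (auto simp: unit_vec_def)
    then show ?thesis
      using tnorm_upper[OF unit_vec_tsirelson that, of 0] by (simp add: tnorm_unit_vec)
  qed
  show "sum (unit_vec 0) {..<n} = 1" using assms by (simp add: unit_vec_def)
qed (use assms in \<open>auto simp: unit_vec_def\<close>)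

text \<open>The rate \<open>1 / 20\<close> is set by the middle range, where
  \<open>2 powr (10 / 20) = sqrt 2\<close>. In the last range \<open>?k \<le> 5 + 2 * j\<close> and
  \<open>10 < ?k\<close> give \<open>?k \<le> 10 * j\<close>.\<close>

lemma distortion_ge_inverse_ackermann:
  assumes "1 \<le> n"
  shows "ereal (2 powr (1 / 20 * inverse_ackermann n))
    \<le> euclidean_distortion (span (unit_vec ` {..<n})) tnorm"
proof -
  let ?k = "inverse_ackermann n"
  consider "n \<le> 3" | "3 < n" "?k \<le> 10" | "3 < n" "10 < ?k" by linarith
  then show ?thesis
  proof cases
    case 1
    then have "?k = 0" by (simp add: inverse_ackermann_def)
    then show ?thesis using distortion_ge_1[OF assms] by simp
  next
    case 2
    have "2 powr (1 / 20 * ?k) \<le> 2 powr (1 / 2)" using 2 by (intro powr_mono) auto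
    also have "\<dots> = sqrt 2" by (simp add: powr_half_sqrt)
    finally have "ereal (2 powr (1 / 20 * ?k)) \<le> ereal (sqrt 2)" by simp
    also have "\<dots> \<le> euclidean_distortion (span (unit_vec ` {..<n})) tnorm"
      using 2 by (intro distortion_ge_sqrt_2) simp
    finally show ?thesis .
  next
    case 3
    define j where "j = (?k - 4) div 2"
    have "4 + 2 * j \<le> ?k" "?k \<le> 5 + 2 * j" using 3 by (auto simp: j_def)
    then have "ackermann_g (4 + 2 * j) 2 \<le> ackermann_g ?k 2"
      using strict_mono_less_eq[OF ackermann_g_strict_2] by blast
    then have "ackermann_g (4 + 2 * j) 2 \<le> n" using inverse_ackermann_bounds(1)[OF 3(1)] by linarith
    note distortion_ge_ackermann[OF this]
    moreover have "ereal (2 powr (1 / 20 * ?k)) \<le> ereal (2 powr (j / 2))"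
      using \<open>?k \<le> 5 + 2 * j\<close> 3(2) by simp
    ultimately show ?thesis by (rule order_trans[rotated])
  qed
qed

subsection \<open>A Johnson--Lindenstrauss lemma with Rademacher rows\<close>

text \<open>The expectation over \<open>N\<close> independent signs as an iterated average, so that
  conditioning on the last sign is an induction step. Coordinates from \<open>N\<close> on are set
  to 1.\<close>

primrec sign_avg :: "nat \<Rightarrow> ((nat \<Rightarrow> real) \<Rightarrow> real) \<Rightarrow> real" where
  "sign_avg 0 g = g (\<lambda>_. 1)"
| "sign_avg (Suc N) g =
    (sign_avg N (\<lambda>e. g (e(N := 1))) + sign_avg N (\<lambda>e. g (e(N := - 1)))) / 2"

lemma sign_avg_attained: "\<exists>e. g e \<le> sign_avg N g"
proof (induction N arbitrary: g)
  case (Suc N)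
  obtain e1 e2 where "g (e1(N := 1)) \<le> sign_avg N (\<lambda>e. g (e(N := 1)))"
    "g (e2(N := - 1)) \<le> sign_avg N (\<lambda>e. g (e(N := - 1)))"
    using Suc[of "\<lambda>e. g (e(N := 1))"] Suc[of "\<lambda>e. g (e(N := - 1))"] by blast
  then have "g (e1(N := 1)) \<le> sign_avg (Suc N) g \<or> g (e2(N := - 1)) \<le> sign_avg (Suc N) g"
    by (simp add: field_simps) linarith
  then show ?case by blast
qed auto

lemma sign_avg_add: "sign_avg N (\<lambda>e. g e + h e) = sign_avg N g + sign_avg N h"
  by (induction N arbitrary: g h) (auto simp: field_simps)

lemma sign_avg_cmult: "sign_avg N (\<lambda>e. c * g e) = c * sign_avg N g"
  by (induction N arbitrary: g) (auto simp: field_simps)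

lemma sign_avg_const: "sign_avg N (\<lambda>e. c) = c"
  by (induction N) auto

lemma sign_avg_sum: "sign_avg N (\<lambda>e. \<Sum>a\<in>I. g a e) = (\<Sum>a\<in>I. sign_avg N (g a))"
  by (induction I rule: infinite_finite_induct) (auto simp: sign_avg_add sign_avg_const)

lemma sign_avg_mono: "(\<And>e. g e \<le> h e) \<Longrightarrow> sign_avg N g \<le> sign_avg N h"
proof (induction N arbitrary: g h)
  case (Suc N)
  show ?case
    using Suc.IH[of "\<lambda>e. g (e(N := 1))" "\<lambda>e. h (e(N := 1))"]
      Suc.IH[of "\<lambda>e. g (e(N := - 1))" "\<lambda>e. h (e(N := - 1))"] Suc.prems by simp
qed simp

lemma rademacher_sum_upd:
  "(\<Sum>s<Suc N. (e(N := c)) s * v s) = (\<Sum>s<N. e s * v s) + c * (v N :: real)"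
  by simp

section \<open>Moment bounds for Rademacher sums\<close>

lemma fact_double_ge: "2 ^ n * fact n \<le> (fact (2 * n) :: real)"
proof (induction n)
  case (Suc n)
  have "2 ^ Suc n * fact (Suc n) = (2 * real (Suc n)) * (2 ^ n * fact n)" by simp
  also have "\<dots> \<le> (2 * real (Suc n)) * fact (2 * n)" using Suc by (intro mult_left_mono) auto
  also have "\<dots> \<le> (2 * real (Suc n)) * (real (Suc (2 * n)) * fact (2 * n))"
    by (intro mult_left_mono) (auto simp: mult_le_cancel_right1)
  also have "\<dots> = fact (2 * Suc n)" by (simp add: algebra_simps)
  finally show ?case .
qed simp

text \<open>Termwise comparison of the power series: only even powers occur in \<open>cosh\<close>,
  and \<open>2 ^ n * fact n \<le> fact (2 * n)\<close>.\<close>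

lemma cosh_le_exp_half_square: "cosh x \<le> exp (x\<^sup>2 / 2)" for x :: real
proof -
  have "(\<lambda>n. if even n then x ^ n /\<^sub>R fact n else 0) sums cosh x" by (rule cosh_converges)
  moreover have zero: "(if even n then x ^ n /\<^sub>R fact n else 0) = 0" if "n \<notin> range ((*) 2)" for n
    using that by (auto elim!: evenE)
  ultimately have 1: "(\<lambda>n. x ^ (2 * n) /\<^sub>R fact (2 * n)) sums cosh x"
    using sums_mono_reindex[of "\<lambda>n. 2 * n" "\<lambda>n. if even n then x ^ n /\<^sub>R fact n else 0" "cosh x"]
    using zero by (auto simp: strict_mono_def)
  have 2: "(\<lambda>n. (x\<^sup>2 / 2) ^ n /\<^sub>R fact n) sums exp (x\<^sup>2 / 2)" by (rule exp_converges)
  show ?thesis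
  proof (rule sums_le[OF _ 1 2])
    fix n
    have "x ^ (2 * n) / fact (2 * n) \<le> x ^ (2 * n) / (2 ^ n * fact n)"
      using fact_double_ge[of n] by (intro divide_left_mono) auto
    moreover have "(x\<^sup>2 / 2) ^ n /\<^sub>R fact n = x ^ (2 * n) / (2 ^ n * fact n)"
      by (simp add: power_mult power_divide divide_simps)
    moreover have "x ^ (2 * n) /\<^sub>R fact (2 * n) = x ^ (2 * n) / fact (2 * n)"
      by (simp add: divide_simps)
    ultimately show "x ^ (2 * n) /\<^sub>R fact (2 * n) \<le> (x\<^sup>2 / 2) ^ n /\<^sub>R fact n"
      by (simp only:)
  qed
qed

text \<open>The shift \<open>a\<close> serves the induction: fixing the last sign replaces it by
  \<open>a + v N\<close> or \<open>a - v N\<close>. Each sign lowers the denominator by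
  \<open>2 * (v N)\<^sup>2\<close>, and the hypothesis keeps it positive.\<close>

lemma sign_avg_exp_square:
  fixes v :: "nat \<Rightarrow> real"
  assumes "2 * (\<Sum>s<N. (v s)\<^sup>2) < b"
  shows "sign_avg N (\<lambda>e. exp ((a + (\<Sum>s<N. e s * v s))\<^sup>2 / b))
    \<le> exp ((a\<^sup>2 + (\<Sum>s<N. (v s)\<^sup>2)) / (b - 2 * (\<Sum>s<N. (v s)\<^sup>2)))"
  using assms
proof (induction N arbitrary: a)
  case (Suc N)
  define V where "V = (\<Sum>s<N. (v s)\<^sup>2)"
  define w where "w = v N"
  define c where "c = b - 2 * V"
  have c: "2 * w\<^sup>2 < c" using Suc.prems by (simp add: c_def w_def V_def)
  then have "0 < c" using zero_le_power2[of w] by linarith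
  have V0: "0 \<le> V" by (simp add: V_def sum_nonneg)
  have "2 * V < b" using \<open>0 < c\<close> unfolding c_def by linarith
  then have IH: "sign_avg N (\<lambda>e. exp ((a' + (\<Sum>s<N. e s * v s))\<^sup>2 / b)) \<le> exp ((a'\<^sup>2 + V) / c)" for a'
    using Suc.IH[of a'] by (simp add: V_def c_def)
  have "sign_avg (Suc N) (\<lambda>e. exp ((a + (\<Sum>s<Suc N. e s * v s))\<^sup>2 / b))
      \<le> (exp (((a + w)\<^sup>2 + V) / c) + exp (((a - w)\<^sup>2 + V) / c)) / 2"
    using IH[of "a + w"] IH[of "a - w"]
    unfolding sign_avg.simps rademacher_sum_upd by (simp add: w_def algebra_simps)
  \<comment> \<open>The two exponents differ only in the sign of the cross term
    \<open>2 * a * w / c\<close>.\<close>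
  also have "\<dots> = exp ((a\<^sup>2 + w\<^sup>2 + V) / c) * cosh (2 * a * w / c)"
    by (simp add: cosh_field_def algebra_simps power2_eq_square add_divide_distrib diff_divide_distrib
        flip: exp_add)
  also have "\<dots> \<le> exp ((a\<^sup>2 + w\<^sup>2 + V) / c) * exp ((2 * a * w / c)\<^sup>2 / 2)"
    by (intro mult_left_mono cosh_le_exp_half_square) auto
  also have "\<dots> = exp ((w\<^sup>2 + V) / c + a\<^sup>2 / c * (1 + 2 * w\<^sup>2 / c))"
    using \<open>0 < c\<close> by (simp add: field_simps power2_eq_square flip: exp_add)
  also have "\<dots> \<le> exp ((w\<^sup>2 + V) / (c - 2 * w\<^sup>2) + a\<^sup>2 / (c - 2 * w\<^sup>2))"
  proof -
    have "(w\<^sup>2 + V) / c \<le> (w\<^sup>2 + V) / (c - 2 * w\<^sup>2)"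
      using c V0 \<open>0 < c\<close> by (intro divide_left_mono) auto
    moreover have "1 / c * (1 + 2 * w\<^sup>2 / c) \<le> 1 / (c - 2 * w\<^sup>2)"
    proof -
      have "(c + 2 * w\<^sup>2) * (c - 2 * w\<^sup>2) \<le> c * c" by (simp add: algebra_simps)
      then show ?thesis using c \<open>0 < c\<close> by (simp add: field_simps)
    qed
    then have "a\<^sup>2 * (1 / c * (1 + 2 * w\<^sup>2 / c)) \<le> a\<^sup>2 * (1 / (c - 2 * w\<^sup>2))"
      by (intro mult_left_mono) auto
    ultimately show ?thesis by simp
  qed
  also have "\<dots> = exp ((a\<^sup>2 + (\<Sum>s<Suc N. (v s)\<^sup>2)) / (b - 2 * (\<Sum>s<Suc N. (v s)\<^sup>2)))"
    by (simp add: V_def w_def c_def algebra_simps flip: add_divide_distrib)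
  finally show ?case .
qed simp

lemma sign_avg_square:
  "sign_avg N (\<lambda>e. (a + (\<Sum>s<N. e s * v s))\<^sup>2) = a\<^sup>2 + (\<Sum>s<N. (v s)\<^sup>2)"
proof (induction N arbitrary: a)
  case (Suc N)
  show ?case
    unfolding sign_avg.simps rademacher_sum_upd
    using Suc[of "a + v N"] Suc[of "a - v N"] by (simp add: algebra_simps power2_eq_square)
qed simp

text \<open>Odd powers of the last sign cancel. The recursion leaves a term
  \<open>- 2 * w ^ 4\<close>, which is dropped.\<close>

lemma sign_avg_fourth_power:
  "sign_avg N (\<lambda>e. (a + (\<Sum>s<N. e s * v s)) ^ 4)
    \<le> a ^ 4 + 6 * a\<^sup>2 * (\<Sum>s<N. (v s)\<^sup>2) + 3 * (\<Sum>s<N. (v s)\<^sup>2)\<^sup>2"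
proof (induction N arbitrary: a)
  case (Suc N)
  define V where "V = (\<Sum>s<N. (v s)\<^sup>2)"
  define w where "w = v N"
  have "sign_avg (Suc N) (\<lambda>e. (a + (\<Sum>s<Suc N. e s * v s)) ^ 4)
      \<le> (((a + w) ^ 4 + 6 * (a + w)\<^sup>2 * V + 3 * V\<^sup>2) + ((a - w) ^ 4 + 6 * (a - w)\<^sup>2 * V + 3 * V\<^sup>2)) / 2"
    unfolding sign_avg.simps rademacher_sum_upd
    using Suc[of "a + w"] Suc[of "a - w"] by (simp add: V_def w_def algebra_simps)
  also have "\<dots> = a ^ 4 + 6 * a\<^sup>2 * (V + w\<^sup>2) + 3 * (V + w\<^sup>2)\<^sup>2 - 2 * w ^ 4"
    by (simp add: field_simps power2_eq_square power4_eq_xxxx)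
  also have "\<dots> \<le> a ^ 4 + 6 * a\<^sup>2 * (V + w\<^sup>2) + 3 * (V + w\<^sup>2)\<^sup>2" by simp
  finally show ?case by (simp add: V_def w_def)
qed simp

lemma exp_minus_le_quadratic: "0 \<le> y \<Longrightarrow> exp (- y) \<le> 1 - y + y\<^sup>2 / 2" for y :: real
proof -
  assume "0 \<le> y"
  obtain t where "exp (- y) = (\<Sum>m<3. (- y) ^ m / fact m) + exp t / fact 3 * (- y) ^ 3"
    using Maclaurin_exp_le[of "- y" 3] by blast
  moreover have "exp t / fact 3 * (- y) ^ 3 \<le> 0" using \<open>0 \<le> y\<close> by (simp add: mult_nonneg_nonpos)
  ultimately show ?thesis by (simp add: eval_nat_numeral field_simps)
qed

text \<open>With second moment 1 and fourth moment at most 3, the quadratic bound gives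
  \<open>1 - 1 / 3 + 3 / 18 = 5 / 6\<close>.\<close>

lemma sign_avg_exp_minus_square:
  fixes v :: "nat \<Rightarrow> real"
  assumes "(\<Sum>s<N. (v s)\<^sup>2) = 1"
  shows "sign_avg N (\<lambda>e. exp (- ((\<Sum>s<N. e s * v s)\<^sup>2 / 3))) \<le> 5 / 6"
proof -
  have "exp (- (x\<^sup>2 / 3)) \<le> 1 + ((- 1 / 3) * x\<^sup>2 + (1 / 18) * x ^ 4)" for x :: real
    using exp_minus_le_quadratic[of "x\<^sup>2 / 3"] by (simp add: power_divide flip: power_mult)
  then have "sign_avg N (\<lambda>e. exp (- ((\<Sum>s<N. e s * v s)\<^sup>2 / 3)))
      \<le> sign_avg N (\<lambda>e. 1 + ((- 1 / 3) * (\<Sum>s<N. e s * v s)\<^sup>2 + (1 / 18) * (\<Sum>s<N. e s * v s) ^ 4))"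
    by (intro sign_avg_mono)
  also have "\<dots> \<le> 5 / 6"
    unfolding sign_avg_add sign_avg_cmult sign_avg_const
    using sign_avg_square[of N 0 v] sign_avg_fourth_power[of N 0 v] assms by simp
  finally show ?thesis .
qed

text \<open>The rows of the matrix are chosen one at a time by the method of conditional expectations.\<close>

lemma johnson_lindenstrauss_potential:
  fixes v :: "'i \<Rightarrow> nat \<Rightarrow> real"
  assumes unit: "\<And>a. a \<in> I \<Longrightarrow> (\<Sum>s<N. (v a s)\<^sup>2) = 1"
  shows "\<exists>L. (\<Sum>a\<in>I. exp (\<Sum>i<k. (\<Sum>s<N. L i s * v a s)\<^sup>2 / 4 - 3 / 2)
      + exp (\<Sum>i<k. 1 / 12 - (\<Sum>s<N. L i s * v a s)\<^sup>2 / 3)) \<le> 2 * real (card I) * (10 / 11) ^ k"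
proof (induction k)
  case (Suc k)
  then obtain L :: "nat \<Rightarrow> nat \<Rightarrow> real" where
    L: "(\<Sum>a\<in>I. exp (\<Sum>i<k. (\<Sum>s<N. L i s * v a s)\<^sup>2 / 4 - 3 / 2)
      + exp (\<Sum>i<k. 1 / 12 - (\<Sum>s<N. L i s * v a s)\<^sup>2 / 3)) \<le> 2 * real (card I) * (10 / 11) ^ k" by blast
  define A where "A a = exp (\<Sum>i<k. (\<Sum>s<N. L i s * v a s)\<^sup>2 / 4 - 3 / 2)" for a
  define B where "B a = exp (\<Sum>i<k. 1 / 12 - (\<Sum>s<N. L i s * v a s)\<^sup>2 / 3)" for a
  define g where "g e = (\<Sum>a\<in>I. (A a * exp (- (3 / 2))) * exp ((\<Sum>s<N. e s * v a s)\<^sup>2 / 4)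
      + (B a * exp (1 / 12)) * exp (- ((\<Sum>s<N. e s * v a s)\<^sup>2 / 3)))" for e
  obtain e where e: "g e \<le> sign_avg N g" using sign_avg_attained by blast
  have "sign_avg N g = (\<Sum>a\<in>I. (A a * exp (- (3 / 2))) * sign_avg N (\<lambda>e. exp ((\<Sum>s<N. e s * v a s)\<^sup>2 / 4))
      + (B a * exp (1 / 12)) * sign_avg N (\<lambda>e. exp (- ((\<Sum>s<N. e s * v a s)\<^sup>2 / 3))))"
    unfolding g_def by (simp only: sign_avg_sum sign_avg_add sign_avg_cmult)
  also have "\<dots> \<le> (\<Sum>a\<in>I. (A a + B a) * (10 / 11))"
  proof (rule sum_mono)
    fix a assume a: "a \<in> I"
    \<comment> \<open>For variance 1 and denominator 4 the exponential moment bound is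
      \<open>exp (1 / (4 - 2))\<close>. The offset \<open>3 / 2\<close> then leaves
      \<open>exp (- 1)\<close>.\<close>
    have "sign_avg N (\<lambda>e. exp ((\<Sum>s<N. e s * v a s)\<^sup>2 / 4)) \<le> exp (1 / 2)"
      using sign_avg_exp_square[of "v a" N 4 0] unit[OF a] by simp
    then have "(A a * exp (- (3 / 2))) * sign_avg N (\<lambda>e. exp ((\<Sum>s<N. e s * v a s)\<^sup>2 / 4))
        \<le> (A a * exp (- (3 / 2))) * exp (1 / 2)"
      by (intro mult_left_mono) (auto simp: A_def)
    also have "\<dots> = A a * exp (- 1)" by (simp flip: exp_add)
    also have "\<dots> \<le> A a * (10 / 11)"
    proof -
      have "exp (- 1 :: real) \<le> 1 / 2"
        using exp_ge_add_one_self[of "1::real"] by (simp add: exp_minus field_simps)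
      then show ?thesis by (intro mult_left_mono) (auto simp: A_def)
    qed
    finally have 1: "(A a * exp (- (3 / 2))) * sign_avg N (\<lambda>e. exp ((\<Sum>s<N. e s * v a s)\<^sup>2 / 4))
        \<le> A a * (10 / 11)" .
    have "(B a * exp (1 / 12)) * sign_avg N (\<lambda>e. exp (- ((\<Sum>s<N. e s * v a s)\<^sup>2 / 3)))
        \<le> (B a * exp (1 / 12)) * (5 / 6)"
      by (intro mult_left_mono sign_avg_exp_minus_square unit[OF a]) (auto simp: B_def)
    also have "\<dots> \<le> B a * (10 / 11)"
    proof -
      \<comment> \<open>The offset \<open>1 / 12\<close> is small enough for
        \<open>12 / 11 * (5 / 6) = 10 / 11\<close>.\<close>
      have "exp (1 / 12 :: real) \<le> 12 / 11"
        using exp_ge_add_one_self[of "- 1 / 12 :: real"] by (simp add: exp_minus field_simps)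
      then have "B a * (exp (1 / 12) * (5 / 6)) \<le> B a * (10 / 11)"
        by (intro mult_left_mono) (auto simp: B_def)
      then show ?thesis by simp
    qed
    finally show "(A a * exp (- (3 / 2))) * sign_avg N (\<lambda>e. exp ((\<Sum>s<N. e s * v a s)\<^sup>2 / 4))
      + (B a * exp (1 / 12)) * sign_avg N (\<lambda>e. exp (- ((\<Sum>s<N. e s * v a s)\<^sup>2 / 3)))
      \<le> (A a + B a) * (10 / 11)" using 1 by (simp add: algebra_simps)
  qed
  also have "\<dots> = (\<Sum>a\<in>I. A a + B a) * (10 / 11)" by (rule sum_distrib_right[symmetric])
  also have "\<dots> \<le> 2 * real (card I) * (10 / 11) ^ Suc k"
    using L by (simp add: A_def B_def)
  finally have "g e \<le> 2 * real (card I) * (10 / 11) ^ Suc k" using e by linarith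
  moreover have "g e = (\<Sum>a\<in>I. exp (\<Sum>i<Suc k. (\<Sum>s<N. (L(k := e)) i s * v a s)\<^sup>2 / 4 - 3 / 2)
      + exp (\<Sum>i<Suc k. 1 / 12 - (\<Sum>s<N. (L(k := e)) i s * v a s)\<^sup>2 / 3))"
    unfolding g_def A_def B_def
    by (intro sum.cong refl) (simp add: algebra_simps flip: exp_add)
  ultimately show ?case by (intro exI[of _ "L(k := e)"]) simp
qed simp

text \<open>With \<open>32 * p\<close> rows the potential is at most
  \<open>2 * 4 ^ p * (1 / 16) ^ p < 1\<close>, as \<open>(10 / 11) ^ 32 \<le> 1 / 16\<close>. Every
  exponent in it is then negative, which gives the factors 6 and \<open>1 / 4\<close>.\<close>

lemma johnson_lindenstrauss:
  fixes v :: "'i \<Rightarrow> 'b \<Rightarrow> real"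
  assumes "finite I" "finite J" and card: "card I \<le> 4 ^ p" and "1 \<le> p"
  shows "\<exists>L. \<forall>a\<in>I. (\<Sum>s\<in>J. (v a s)\<^sup>2) / 4 * real (32 * p) \<le> (\<Sum>i<32 * p. (\<Sum>s\<in>J. L i s * v a s)\<^sup>2)
    \<and> (\<Sum>i<32 * p. (\<Sum>s\<in>J. L i s * v a s)\<^sup>2) \<le> 6 * (\<Sum>s\<in>J. (v a s)\<^sup>2) * real (32 * p)"
proof -
  define N where "N = card J"
  define k where "k = 32 * p"
  obtain h where h: "bij_betw h {..<N} J"
    using ex_bij_betw_nat_finite[OF \<open>finite J\<close>] by (auto simp: N_def atLeast0LessThan)
  define V where "V a = sqrt (\<Sum>s\<in>J. (v a s)\<^sup>2)" for a
  have V2: "(V a)\<^sup>2 = (\<Sum>s\<in>J. (v a s)\<^sup>2)" for a by (simp add: V_def sum_nonneg)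
  \<comment> \<open>Zero vectors cannot be normalised; both estimates are trivial for them.\<close>
  define I' where "I' = {a \<in> I. V a \<noteq> 0}"
  have "finite I'" "card I' \<le> 4 ^ p"
    using \<open>finite I\<close> card card_mono[of I I'] by (auto simp: I'_def)
  define u where "u a s = v a (h s) / V a" for a s
  have "(\<Sum>s<N. (u a s)\<^sup>2) = 1" if "a \<in> I'" for a
  proof -
    have "(\<Sum>s<N. (u a s)\<^sup>2) = (\<Sum>s<N. (v a (h s))\<^sup>2) / (V a)\<^sup>2"
      by (simp add: u_def power_divide sum_divide_distrib)
    also have "\<dots> = 1"
      using that sum.reindex_bij_betw[OF h, of "\<lambda>s. (v a s)\<^sup>2"]
      by (simp add: I'_def flip: V2)
    finally show ?thesis .
  qed
  from johnson_lindenstrauss_potential[of I' u N k, OF this] obtain L :: "nat \<Rightarrow> nat \<Rightarrow> real" where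
    L: "(\<Sum>a\<in>I'. exp (\<Sum>i<k. (\<Sum>s<N. L i s * u a s)\<^sup>2 / 4 - 3 / 2)
      + exp (\<Sum>i<k. 1 / 12 - (\<Sum>s<N. L i s * u a s)\<^sup>2 / 3)) \<le> 2 * real (card I') * (10 / 11) ^ k"
    by blast
  have "2 * real (card I') * (10 / 11) ^ k < 1"
  proof -
    have "((10 / 11) ^ k :: real) = ((10 / 11) ^ 32) ^ p" by (simp add: k_def power_mult)
    also have "\<dots> \<le> (1 / 16) ^ p" by (intro power_mono) (auto simp: field_simps)
    finally have "2 * real (card I') * (10 / 11) ^ k \<le> 2 * 4 ^ p * (1 / 16) ^ p"
      using \<open>card I' \<le> 4 ^ p\<close> of_nat_mono[of "card I'" "4 ^ p", where ?'a = real] by (intro mult_mono) auto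
    also have "\<dots> = 2 * (1 / 4) ^ p" by (simp flip: power_mult_distrib)
    also have "(1 / 4 :: real) ^ p \<le> (1 / 4) ^ 1" using \<open>1 \<le> p\<close> by (intro power_decreasing) auto
    finally show ?thesis by simp
  qed
  note small = order_le_less_trans[OF L this]
  define L' where "L' i s = L i (inv_into {..<N} h s)" for i s
  have eq: "(\<Sum>s\<in>J. L' i s * v a s) = V a * (\<Sum>s<N. L i s * u a s)" if "a \<in> I'" for i a
  proof -
    have "(\<Sum>s\<in>J. L' i s * v a s) = (\<Sum>s<N. L i s * v a (h s))"
      using sum.reindex_bij_betw[OF h, of "\<lambda>s. L' i s * v a s"] h
      by (simp add: L'_def bij_betw_inv_into_left)
    also have "\<dots> = V a * (\<Sum>s<N. L i s * u a s)"
      using that by (simp add: sum_distrib_left u_def I'_def)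
    finally show ?thesis .
  qed
  show ?thesis
  proof (rule exI[of _ L'], rule ballI, unfold k_def[symmetric])
    fix a assume a: "a \<in> I"
    show "(\<Sum>s\<in>J. (v a s)\<^sup>2) / 4 * real k \<le> (\<Sum>i<k. (\<Sum>s\<in>J. L' i s * v a s)\<^sup>2)
      \<and> (\<Sum>i<k. (\<Sum>s\<in>J. L' i s * v a s)\<^sup>2) \<le> 6 * (\<Sum>s\<in>J. (v a s)\<^sup>2) * real k"
    proof (cases "a \<in> I'")
      case False
      then have "(\<Sum>s\<in>J. (v a s)\<^sup>2) = 0" using a V2[of a] by (auto simp: I'_def)
      moreover from this have "\<forall>s\<in>J. v a s = 0" using \<open>finite J\<close> by (simp add: sum_nonneg_eq_0_iff)
      ultimately show ?thesis by simp
    next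
      case True
      define Y where "Y = (\<Sum>i<k. (\<Sum>s<N. L i s * u a s)\<^sup>2)"
      have Y: "(\<Sum>i<k. (\<Sum>s\<in>J. L' i s * v a s)\<^sup>2) = (V a)\<^sup>2 * Y"
        unfolding eq[OF True] power_mult_distrib Y_def by (rule sum_distrib_left[symmetric])
      have "exp (\<Sum>i<k. (\<Sum>s<N. L i s * u a s)\<^sup>2 / 4 - 3 / 2)
          + exp (\<Sum>i<k. 1 / 12 - (\<Sum>s<N. L i s * u a s)\<^sup>2 / 3) < 1"
        by (rule order_le_less_trans[OF member_le_sum[OF True] small])
          (auto simp: \<open>finite I'\<close> intro: add_nonneg_nonneg)
      moreover have "(\<Sum>i<k. (\<Sum>s<N. L i s * u a s)\<^sup>2 / 4 - 3 / 2) = Y / 4 - 3 / 2 * k"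
        by (simp add: Y_def sum_subtractf sum_divide_distrib)
      moreover have "(\<Sum>i<k. 1 / 12 - (\<Sum>s<N. L i s * u a s)\<^sup>2 / 3) = k / 12 - Y / 3"
        by (simp add: Y_def sum_subtractf sum_divide_distrib)
      ultimately have sum1: "exp (Y / 4 - 3 / 2 * k) + exp (k / 12 - Y / 3) < 1" by simp
      have "exp (Y / 4 - 3 / 2 * k) < 1" "exp (k / 12 - Y / 3) < 1"
        using sum1 exp_gt_zero[of "Y / 4 - 3 / 2 * k"] exp_gt_zero[of "k / 12 - Y / 3"] by linarith+
      then have "Y \<le> 6 * k" "k / 4 \<le> Y" by simp_all
      then have "(V a)\<^sup>2 * (k / 4) \<le> (V a)\<^sup>2 * Y" "(V a)\<^sup>2 * Y \<le> (V a)\<^sup>2 * (6 * k)"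
        by (intro mult_left_mono; simp)+
      then show ?thesis unfolding Y V2[symmetric] by (simp add: algebra_simps)
    qed
  qed
qed

subsection \<open>Linear sketches of finite sets\<close>

text \<open>Coordinates are classified by their vectors of rounded values, with at most
  \<open>2 * q + 1\<close> values per entry. The least member from \<open>m\<close> on represents
  its class, so representatives stay in the tail.\<close>

lemma quantization:
  fixes z :: "'i \<Rightarrow> nat \<Rightarrow> real"
  assumes "finite I" "0 < q" and z: "\<And>a t. a \<in> I \<Longrightarrow> m \<le> t \<Longrightarrow> \<bar>z a t\<bar> \<le> 1"
  shows "\<exists>rep. finite (rep ` {m..}) \<and> card (rep ` {m..}) \<le> (2 * q + 1) ^ card I \<and>
    (\<forall>t\<ge>m. m \<le> rep t \<and> (\<forall>a\<in>I. \<bar>z a t - z a (rep t)\<bar> \<le> 1 / real q))"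
proof -
  define \<kappa> where "\<kappa> t = (\<lambda>a\<in>I. \<lfloor>q * z a t\<rfloor>)" for t
  define g where "g k = (LEAST u. m \<le> u \<and> \<kappa> u = k)" for k
  define rep where "rep t = g (\<kappa> t)" for t
  have "\<lfloor>q * z a t\<rfloor> \<in> {- int q..int q}" if "a \<in> I" "m \<le> t" for a t
  proof -
    have "- real q \<le> q * z a t" "q * z a t \<le> real q"
      using z[OF that] mult_left_mono[of "- 1" "z a t" "real q"] mult_left_mono[of "z a t" 1 "real q"]
      by (auto simp: abs_le_iff)
    then have "- int q \<le> \<lfloor>q * z a t\<rfloor>" "\<lfloor>q * z a t\<rfloor> \<le> int q" by linarith+
    then show ?thesis by simp
  qed
  then have sub: "\<kappa> ` {m..} \<subseteq> (\<Pi>\<^sub>E a\<in>I. {- int q..int q})" by (auto simp: \<kappa>_def)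
  have fin: "finite (\<Pi>\<^sub>E a\<in>I. {- int q..int q})" using \<open>finite I\<close> by (intro finite_PiE) auto
  have eq: "rep ` {m..} = g ` \<kappa> ` {m..}" by (auto simp: rep_def)
  have "card (rep ` {m..}) \<le> card (\<kappa> ` {m..})"
    unfolding eq using finite_subset[OF sub fin] by (rule card_image_le)
  also have "\<dots> \<le> card (\<Pi>\<^sub>E a\<in>I. {- int q..int q})" by (rule card_mono[OF fin sub])
  also have "\<dots> = (2 * q + 1) ^ card I"
    using \<open>finite I\<close> by (simp add: card_PiE nat_add_distrib nat_mult_distrib)
  finally have card: "card (rep ` {m..}) \<le> (2 * q + 1) ^ card I" .
  have rep: "m \<le> rep t \<and> \<kappa> (rep t) = \<kappa> t" if "m \<le> t" for t
    unfolding rep_def g_def using that by (intro LeastI[of "\<lambda>u. m \<le> u \<and> \<kappa> u = \<kappa> t" t]) auto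
  have "\<bar>z a t - z a (rep t)\<bar> \<le> 1 / real q" if "m \<le> t" "a \<in> I" for t a
  proof -
    have "\<lfloor>q * z a (rep t)\<rfloor> = \<lfloor>q * z a t\<rfloor>"
    proof -
      have "\<kappa> (rep t) a = \<kappa> t a" using rep[OF that(1)] by simp
      then show ?thesis using that(2) by (simp add: \<kappa>_def)
    qed
    then have "\<bar>q * z a t - q * z a (rep t)\<bar> \<le> 1" by linarith
    then have "q * \<bar>z a t - z a (rep t)\<bar> \<le> 1"
      by (simp flip: right_diff_distrib add: abs_mult)
    then show ?thesis using \<open>0 < q\<close> by (simp add: field_simps)
  qed
  then show ?thesis
    using rep card finite_subset[OF sub fin] by (intro exI[of _ rep]) (auto simp: eq)
qed

lemma tnorm_sum:
  assumes "finite I" "\<And>a. a \<in> I \<Longrightarrow> f a \<in> tsirelson"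
  shows "(\<lambda>t. \<Sum>a\<in>I. f a t) \<in> tsirelson \<and> tnorm (\<lambda>t. \<Sum>a\<in>I. f a t) \<le> (\<Sum>a\<in>I. tnorm (f a))"
  using assms
proof (induction I)
  case empty
  then show ?case using tnorm_zero by simp
next
  case (insert a I)
  then show ?case using tnorm_triangle[of "f a" "\<lambda>t. \<Sum>a\<in>I. f a t"] by force
qed

text \<open>The count is at most 2 to the power \<open>2 ^ (4 * p + 4)\<close>, well within
  \<open>adm (32 * p)\<close>; the number 32 is the row count per unit of \<open>p\<close> in
  \<open>johnson_lindenstrauss\<close>.\<close>

lemma quantization_classes_le_adm:
  assumes "1 \<le> p" "c \<le> 4 ^ p"
  shows "(2 * 4 ^ Suc p + 1) ^ c \<le> adm (32 * p)"
proof -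
  have "(2 * 4 ^ Suc p + 1 :: nat) \<le> 2 ^ (2 * p + 4)"
    by (simp add: power_add power_mult)
  then have "(2 * 4 ^ Suc p + 1 :: nat) ^ c \<le> (2 ^ (2 * p + 4)) ^ c" by (rule power_mono) simp
  also have "\<dots> = 2 ^ ((2 * p + 4) * c)" by (simp add: power_mult)
  also have "\<dots> \<le> 2 ^ (2 ^ (32 * p))"
  proof (intro power_increasing)
    have "(2 * p + 4) * c \<le> 2 ^ (2 * p + 4) * 4 ^ p"
      using assms(2) less_exp[of "2 * p + 4"] by (intro mult_le_mono) auto
    also have "(4::nat) ^ p = 2 ^ (2 * p)" by (simp add: power_mult)
    also have "2 ^ (2 * p + 4) * 2 ^ (2 * p) = (2::nat) ^ (2 * p + 4 + 2 * p)"
      by (rule power_add[symmetric])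
    also have "\<dots> \<le> 2 ^ (32 * p)" using assms(1) by (intro power_increasing) auto
    finally show "(2 * p + 4) * c \<le> 2 ^ (32 * p)" .
  qed simp
  finally show ?thesis by (simp add: adm_def)
qed

text \<open>Dividing by \<open>r\<close> and rounding replaces the tails of the vectors \<open>d a\<close> by combinations of few
  disjoint vectors \<open>\<rho> s\<close>, whose span is almost Euclidean. Values are transported from a
  representative \<open>rep t\<close> to \<open>t\<close>, so that the replacement is linear in the vector.\<close>

lemma tail_sketch:
  fixes d :: "'i \<Rightarrow> nat \<Rightarrow> real"
  assumes I: "finite I" "card I \<le> 4 ^ p" and "1 \<le> p" and m: "m = 32 * p"
    and d: "\<And>a. a \<in> I \<Longrightarrow> d a \<in> tsirelson"
  shows "\<exists>A c. \<forall>a\<in>I. \<exists>U\<in>tsirelson.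
    U = (\<lambda>t. if m \<le> t \<and> t < 2 * m then \<Sum>s\<in>A. c (t - m) s * d a s else 0) \<and>
    tnorm (\<lambda>t. if m \<le> t then d a t else 0) \<le> 4 * tnorm U \<and>
    tnorm U \<le> 5 * tnorm (\<lambda>t. if m \<le> t then d a t else 0)"
proof -
  define N where "N a = tnorm (\<lambda>t. if m \<le> t then d a t else 0)" for a
  have tail: "(\<lambda>t. if m \<le> t then d a t else 0) \<in> tsirelson" if "a \<in> I" for a
    by (intro restrict_tsirelson d that)
  have N0: "0 \<le> N a" if "a \<in> I" for a unfolding N_def by (rule tnorm_nonneg[OF tail[OF that]])
  \<comment> \<open>A common majorant of the normalised differences. If \<open>N a = 0\<close> the
    quotient is 0 by convention, and the tail of \<open>d a\<close> vanishes anyway.\<close>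
  define r where "r t = (\<Sum>a\<in>I. \<bar>d a t\<bar> / N a)" for t
  define R where "R t = (if m \<le> t then r t else 0)" for t
  have "R \<in> tsirelson \<and> tnorm R \<le> 4 ^ p"
  proof -
    have f: "(\<lambda>t. (1 / N a) * \<bar>if m \<le> t then d a t else 0\<bar>) \<in> tsirelson
      \<and> tnorm (\<lambda>t. (1 / N a) * \<bar>if m \<le> t then d a t else 0\<bar>) \<le> 1" if "a \<in> I" for a
    proof -
      have "\<bar>(1 / N a) * \<bar>if m \<le> t then d a t else 0\<bar>\<bar> \<le> 1 / N a * \<bar>if m \<le> t then d a t else 0\<bar>" for t
        using N0[OF that] by (simp add: abs_mult)
      from tnorm_mono[OF tail[OF that] this] N0[OF that] show ?thesis
        by (cases "N a = 0") (auto simp: N_def)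
    qed
    have R: "R = (\<lambda>t. \<Sum>a\<in>I. (1 / N a) * \<bar>if m \<le> t then d a t else 0\<bar>)"
      by (auto simp: R_def r_def fun_eq_iff)
    have "tnorm R \<le> (\<Sum>a\<in>I. tnorm (\<lambda>t. (1 / N a) * \<bar>if m \<le> t then d a t else 0\<bar>))"
      unfolding R using tnorm_sum[OF I(1), of "\<lambda>a t. (1 / N a) * \<bar>if m \<le> t then d a t else 0\<bar>"] f by blast
    also have "\<dots> \<le> (\<Sum>a\<in>I. 1)" using f by (intro sum_mono) blast
    also have "\<dots> \<le> 4 ^ p" using of_nat_mono[OF I(2), where ?'a = real] by simp
    finally show ?thesis
      using tnorm_sum[OF I(1), of "\<lambda>a t. (1 / N a) * \<bar>if m \<le> t then d a t else 0\<bar>"] f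
      unfolding R by blast
  qed
  then have R: "R \<in> tsirelson" "tnorm R \<le> 4 ^ p" by auto
  \<comment> \<open>The ratios to be rounded. Precision \<open>1 / 4 ^ Suc p\<close> against
    \<open>tnorm R \<le> 4 ^ p\<close> makes the total error at most \<open>N a / 4\<close>.\<close>
  define z where "z a t = d a t / (r t * N a)" for a t
  have le_r: "\<bar>d a t\<bar> / N a \<le> r t" if "a \<in> I" for a t
    unfolding r_def using that I(1) N0 by (intro member_le_sum) auto
  have r0: "0 \<le> r t" for t unfolding r_def using N0 by (intro sum_nonneg divide_nonneg_nonneg) auto
  have "\<bar>z a t\<bar> \<le> 1" if "a \<in> I" for a t
  proof -
    have "\<bar>z a t\<bar> = (\<bar>d a t\<bar> / N a) / r t"
      using N0[OF that] r0[of t] by (simp add: z_def abs_mult abs_divide)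
    also have "\<dots> \<le> 1" 
      unfolding divide_le_eq_1 using le_r[OF that, of t] r0[of t] by (auto simp: less_le)
    finally show ?thesis .
  qed
  then obtain rep where rep: "finite (rep ` {m..})"
    "card (rep ` {m..}) \<le> (2 * 4 ^ Suc p + 1) ^ card I"
    "\<And>t. m \<le> t \<Longrightarrow> m \<le> rep t"
    "\<And>t a. m \<le> t \<Longrightarrow> a \<in> I \<Longrightarrow> \<bar>z a t - z a (rep t)\<bar> \<le> 1 / real (4 ^ Suc p)"
    using quantization[OF I(1), of "4 ^ Suc p" m z] by auto
  define J where "J = rep ` {m..}"
  have J: "finite J" "card J \<le> adm m"
    using rep(1,2) quantization_classes_le_adm[OF \<open>1 \<le> p\<close> I(2)] by (auto simp: J_def m)
  define \<rho> where "\<rho> s t = (if rep t = s then R t else 0)" for s t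
  have \<rho>: "\<rho> s \<in> tsirelson" for s unfolding \<rho>_def[abs_def] by (intro restrict_tsirelson R)
  \<comment> \<open>Up to sign, \<open>v a s\<close> is the norm of the part in class
    \<open>s\<close> of the approximant \<open>Z\<close> below.\<close>
  define v where "v a s = d a s / r s * tnorm (\<rho> s)" for a s
  obtain L where L: "\<And>a. a \<in> I \<Longrightarrow> (\<Sum>s\<in>J. (v a s)\<^sup>2) / 4 * m \<le> (\<Sum>i<m. (\<Sum>s\<in>J. L i s * v a s)\<^sup>2)"
    "\<And>a. a \<in> I \<Longrightarrow> (\<Sum>i<m. (\<Sum>s\<in>J. L i s * v a s)\<^sup>2) \<le> 6 * (\<Sum>s\<in>J. (v a s)\<^sup>2) * m"
    using johnson_lindenstrauss[OF I(1) J(1) I(2) \<open>1 \<le> p\<close>, of v] unfolding m by blast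
  have m0: "0 < m" using \<open>1 \<le> p\<close> by (simp add: m)
  \<comment> \<open>These coefficients do not depend on \<open>a\<close>, so the sketch is linear in
    \<open>d a\<close>; \<open>sqrt m\<close> normalises the \<open>m\<close> rows.\<close>
  define c where "c i s = L i s * tnorm (\<rho> s) / r s / sqrt m" for i s
  have "\<exists>U\<in>tsirelson. U = (\<lambda>t. if m \<le> t \<and> t < 2 * m then \<Sum>s\<in>J. c (t - m) s * d a s else 0) \<and>
    N a \<le> 4 * tnorm U \<and> tnorm U \<le> 5 * N a" if a: "a \<in> I" for a
  proof -
    \<comment> \<open>The ratio of \<open>d a\<close> to \<open>r\<close> is frozen at the
      representative, so \<open>Z\<close> combines the disjoint vectors
      \<open>\<rho> s\<close>.\<close>
    define Z where "Z t = R t * (d a (rep t) / r (rep t))" for t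
    define H where "H = (\<Sum>s\<in>J. (v a s)\<^sup>2)"
    have Z_part: "(\<lambda>t. if rep t = s then Z t else 0) = (\<lambda>t. (d a s / r s) * \<rho> s t)" for s
      by (auto simp: Z_def \<rho>_def)
    have Z_norm: "(tnorm (\<lambda>t. if rep t = s then Z t else 0))\<^sup>2 = (v a s)\<^sup>2" for s
      unfolding Z_part tnorm_scale(2)[OF \<rho>] by (simp add: v_def power_mult_distrib power_divide)
    have Z: "Z \<in> tsirelson" "(tnorm Z)\<^sup>2 \<le> H"
    proof -
      have *: "(\<lambda>t. if rep t = s then Z t else 0) \<in> tsirelson" for s
        unfolding Z_part by (intro tnorm_scale \<rho>)
      have **: "rep t \<in> J" if "Z t \<noteq> 0" for t using that by (auto simp: Z_def R_def J_def split: if_splits)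
      show "Z \<in> tsirelson" "(tnorm Z)\<^sup>2 \<le> H"
        using tnorm_disjoint_upper[OF J(1), of rep Z, OF * **] by (simp_all add: Z_norm H_def)
    qed
    have H_le: "H \<le> 2 * (tnorm Z)\<^sup>2"
      using tnorm_disjoint_lower[OF J Z(1), of rep] by (simp add: Z_norm H_def Z_def R_def)
    have err: "\<bar>(if m \<le> t then d a t else 0) - Z t\<bar> \<le> (N a / 4 ^ Suc p) * \<bar>R t\<bar>" for t
    proof (cases "m \<le> t")
      case True
      show ?thesis
      proof (cases "N a = 0")
        case True
        have "d a u = 0" if "m \<le> u" for u
          using coord_le_tnorm[OF tail[OF a], of u] True that by (simp add: N_def)
        then show ?thesis using \<open>m \<le> t\<close> rep(3) N0[OF a] by (simp add: Z_def)
      next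
        case False
        have "d a t = r t * N a * z a t"
          using le_r[OF a, of t] False N0[OF a] by (cases "r t = 0") (auto simp: z_def divide_le_0_iff)
        moreover have "Z t = r t * N a * z a (rep t)"
          using True False by (simp add: Z_def R_def z_def)
        ultimately have "\<bar>(if m \<le> t then d a t else 0) - Z t\<bar> = r t * N a * \<bar>z a t - z a (rep t)\<bar>"
          using True r0[of t] N0[OF a] by (simp add: abs_mult flip: right_diff_distrib)
        also have "\<dots> \<le> r t * N a * (1 / real (4 ^ Suc p))"
          using rep(4)[OF True a] r0[of t] N0[OF a] by (intro mult_left_mono) auto
        finally show ?thesis using True r0[of t] by (simp add: R_def mult.commute)
      qed
    qed (simp add: Z_def R_def)
    have E: "(\<lambda>t. (if m \<le> t then d a t else 0) - Z t) \<in> tsirelson"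
      "tnorm (\<lambda>t. (if m \<le> t then d a t else 0) - Z t) \<le> N a / 4"
    proof -
      have "0 \<le> N a / 4 ^ Suc p" using N0[OF a] by simp
      note * = tnorm_mono[OF R(1) err this]
      show "(\<lambda>t. (if m \<le> t then d a t else 0) - Z t) \<in> tsirelson" by (rule *(1))
      have "tnorm (\<lambda>t. (if m \<le> t then d a t else 0) - Z t) \<le> (N a / 4 ^ Suc p) * 4 ^ p"
        using *(2) mult_left_mono[OF R(2) \<open>0 \<le> N a / 4 ^ Suc p\<close>] by linarith
      then show "tnorm (\<lambda>t. (if m \<le> t then d a t else 0) - Z t) \<le> N a / 4" by simp
    qed
    have "N a \<le> tnorm Z + N a / 4"
      using tnorm_triangle(2)[OF Z(1) E(1)] E(2) by (simp add: N_def)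
    then have Z_ge: "3 / 4 * N a \<le> tnorm Z" by simp
    have "Z = (\<lambda>t. (if m \<le> t then d a t else 0) + (- 1) * ((if m \<le> t then d a t else 0) - Z t))"
      by auto
    then have "tnorm Z \<le> N a + tnorm (\<lambda>t. (- 1) * ((if m \<le> t then d a t else 0) - Z t))"
      using tnorm_triangle(2)[OF tail[OF a] tnorm_scale(1)[OF E(1), of "- 1"]] unfolding N_def by simp
    then have Z_le: "tnorm Z \<le> 5 / 4 * N a"
      using tnorm_scale(2)[OF E(1), of "- 1"] E(2) by simp
    define U where "U = (\<lambda>t. if m \<le> t \<and> t < 2 * m then \<Sum>s\<in>J. c (t - m) s * d a s else 0)"
    have U_part: "(\<lambda>t. if t = s then U t else 0) = (\<lambda>t. U s * unit_vec s t)" for s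
      by (auto simp: unit_vec_def)
    have U_norm: "(tnorm (\<lambda>t. if t = s then U t else 0))\<^sup>2 = (U s)\<^sup>2" for s
      unfolding U_part tnorm_scale(2)[OF unit_vec_tsirelson] by (simp add: tnorm_unit_vec)
    have U: "U \<in> tsirelson" "(tnorm U)\<^sup>2 \<le> (\<Sum>s=m..<2 * m. (U s)\<^sup>2)"
    proof -
      have *: "(\<lambda>t. if t = s then U t else 0) \<in> tsirelson" for s
        unfolding U_part by (intro tnorm_scale unit_vec_tsirelson)
      have **: "t \<in> {m..<2 * m}" if "U t \<noteq> 0" for t using that by (auto simp: U_def split: if_splits)
      show "U \<in> tsirelson" "(tnorm U)\<^sup>2 \<le> (\<Sum>s=m..<2 * m. (U s)\<^sup>2)"
        using tnorm_disjoint_upper[of "{m..<2 * m}" "\<lambda>t. t" U, OF _ * **] by (simp_all add: U_norm)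
    qed
    \<comment> \<open>The \<open>m\<close> unit vectors from \<open>m\<close> on are admissible
      because \<open>m \<le> adm m\<close>, so they span an almost Euclidean target.\<close>
    have U_ge: "(\<Sum>s=m..<2 * m. (U s)\<^sup>2) \<le> 2 * (tnorm U)\<^sup>2"
      using tnorm_disjoint_lower[OF _ _ U(1), of "{m..<2 * m}" m "\<lambda>t. t"] le_adm[of m]
      by (simp add: U_norm U_def)
    have "(\<Sum>s=m..<2 * m. (U s)\<^sup>2) = (\<Sum>i<m. (U (i + m))\<^sup>2)"
      using sum.shift_bounds_nat_ivl[of "\<lambda>s. (U s)\<^sup>2" 0 m m] by (simp add: atLeast0LessThan mult_2)
    also have "\<dots> = (\<Sum>i<m. (\<Sum>s\<in>J. L i s * v a s)\<^sup>2 / m)"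
    proof (intro sum.cong refl)
      fix i assume "i \<in> {..<m}"
      then have "U (i + m) = (\<Sum>s\<in>J. L i s * v a s) / sqrt m"
        by (simp add: U_def c_def v_def sum_divide_distrib algebra_simps)
      then show "(U (i + m))\<^sup>2 = (\<Sum>s\<in>J. L i s * v a s)\<^sup>2 / m" by (simp add: power_divide)
    qed
    also have "\<dots> = (\<Sum>i<m. (\<Sum>s\<in>J. L i s * v a s)\<^sup>2) / m" by (rule sum_divide_distrib[symmetric])
    finally have sum_U: "(\<Sum>s=m..<2 * m. (U s)\<^sup>2) = (\<Sum>i<m. (\<Sum>s\<in>J. L i s * v a s)\<^sup>2) / m" .
    have sum_bounds: "H / 4 \<le> (\<Sum>s=m..<2 * m. (U s)\<^sup>2)" "(\<Sum>s=m..<2 * m. (U s)\<^sup>2) \<le> 6 * H"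
      unfolding sum_U using L[OF a] m0 by (simp_all add: H_def field_simps)
    \<comment> \<open>\<open>12 * (5 / 4)\<^sup>2 = 18.75 \<le> 25\<close>; below,
      \<open>8 * (4 / 3)\<^sup>2 = 128 / 9 \<le> 16\<close> gives the factor 4.\<close>
    have "(tnorm U)\<^sup>2 \<le> (5 * N a)\<^sup>2"
    proof -
      have "(tnorm Z)\<^sup>2 \<le> (5 / 4 * N a)\<^sup>2"
        using Z_le tnorm_nonneg[OF Z(1)] by (intro power_mono) auto
      then have "(tnorm U)\<^sup>2 \<le> 12 * (5 / 4 * N a)\<^sup>2" using U(2) sum_bounds(2) H_le by linarith
      then show ?thesis
        by (simp add: power_mult_distrib power_divide) (use zero_le_power2[of "N a"] in linarith)
    qed
    then have 1: "tnorm U \<le> 5 * N a" by (rule power2_le_imp_le) (use N0[OF a] in simp)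
    have "(N a)\<^sup>2 \<le> (4 * tnorm U)\<^sup>2"
    proof -
      have "(3 / 4 * N a)\<^sup>2 \<le> (tnorm Z)\<^sup>2"
        using Z_ge N0[OF a] by (intro power_mono) auto
      then have "(3 / 4 * N a)\<^sup>2 \<le> 8 * (tnorm U)\<^sup>2" using U_ge sum_bounds(1) Z(2) by linarith
      then show ?thesis
        by (simp add: power_mult_distrib power_divide) (use zero_le_power2[of "tnorm U"] in linarith)
    qed
    then have 2: "N a \<le> 4 * tnorm U" 
      by (rule power2_le_imp_le) (use tnorm_nonneg[OF U(1)] in simp)
    show ?thesis using U(1) 1 2 U_def by blast
  qed
  then show ?thesis unfolding N_def by blast
qed

section \<open>Assembling the linear map\<close>

lemma exponent_exists:
  assumes "2 \<le> n"
  shows "\<exists>p\<ge>1. n \<le> 2 ^ p \<and> real p \<le> 4 * ln (real n)"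
proof -
  define p where "p = (LEAST p. n \<le> 2 ^ p)"
  have p: "n \<le> 2 ^ p" unfolding p_def by (rule LeastI[of _ n]) (simp add: less_imp_le)
  with assms have "p \<noteq> 0" by (intro notI) simp
  then obtain k where k: "p = Suc k" by (cases p) auto
  have "2 ^ k < n" using not_less_Least[of k "\<lambda>p. n \<le> 2 ^ p"] k unfolding p_def by simp
  then have "2 ^ k < real n" by (metis of_nat_less_iff of_nat_numeral of_nat_power)
  then have "ln (2 ^ k) \<le> ln (real n)" by (subst ln_le_cancel_iff) (use assms in auto)
  then have "k * ln 2 \<le> ln (real n)" by (simp add: ln_realpow)
  moreover have "ln 2 \<le> ln (real n)" using assms by (subst ln_le_cancel_iff) auto
  moreover have "1 / 2 \<le> ln (2 :: real)" using ln2_ge_two_thirds by simp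
  then have "k * (1 / 2) \<le> k * ln (2 :: real)" by (intro mult_left_mono) auto
  ultimately have "real p \<le> 4 * ln (real n)" using \<open>1 / 2 \<le> ln 2\<close> by (simp add: k)
  then show ?thesis using p k by auto
qed

lemma tsirelson_johnson_lindenstrauss:
  fixes x :: "nat \<Rightarrow> nat \<Rightarrow> real"
  assumes "1 \<le> p" "n \<le> 2 ^ p" and x: "\<And>i. i \<in> {1..n} \<Longrightarrow> x i \<in> tsirelson"
  shows "\<exists>S. linear_map_on tsirelson (span (unit_vec ` {..<64 * p})) S \<and>
    (\<forall>i\<in>{1..n}. \<forall>j\<in>{1..n}. tnorm (x i - x j) \<le> tnorm (S (x i) - S (x j)) \<and>
      tnorm (S (x i) - S (x j)) \<le> 48 * tnorm (x i - x j))"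
proof -
  define m where "m = 32 * p"
  define d where "d a t = x (fst a) t - x (snd a) t" for a :: "nat \<times> nat" and t
  have d: "d a \<in> tsirelson" if "a \<in> {1..n} \<times> {1..n}" for a
    using that x unfolding d_def[abs_def] by (intro tsirelson_diff) auto
  have "card ({1..n} \<times> {1..n}) \<le> 4 ^ p"
    using mult_le_mono[OF assms(2) assms(2)] by (simp add: card_cartesian_product flip: power_mult_distrib)
  from tail_sketch[OF _ this \<open>1 \<le> p\<close> m_def d]
  obtain A c where Ac: "\<And>a. a \<in> {1..n} \<times> {1..n} \<Longrightarrow> \<exists>U\<in>tsirelson.
    U = (\<lambda>t. if m \<le> t \<and> t < 2 * m then \<Sum>s\<in>A. c (t - m) s * d a s else 0) \<and>
    tnorm (\<lambda>t. if m \<le> t then d a t else 0) \<le> 4 * tnorm U \<and>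
    tnorm U \<le> 5 * tnorm (\<lambda>t. if m \<le> t then d a t else 0)" by fastforce
  \<comment> \<open>The head is copied and the sketch of the tail fills the next \<open>m\<close>
    coordinates. The factor 8 absorbs the loss in the lower bound.\<close>
  define S where "S x t = (if t < m then 8 * x t else if t < 2 * m then 8 * (\<Sum>s\<in>A. c (t - m) s * x s) else 0)"
    for x :: "nat \<Rightarrow> real" and t
  have "linear_map_on tsirelson (span (unit_vec ` {..<64 * p})) S"
    unfolding linear_map_on_def
  proof (intro conjI ballI allI)
    fix x :: "nat \<Rightarrow> real"
    have "S x = (\<Sum>i<64 * p. S x i *\<^sub>R unit_vec i)"
      by (rule ext, subst unit_vec_sum) (auto simp: S_def m_def)
    also have "\<dots> \<in> span (unit_vec ` {..<64 * p})"
      by (intro span_sum span_scale span_base) auto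
    finally show "S x \<in> span (unit_vec ` {..<64 * p})" .
    show "S (x + y) = S x + S y" for y
      by (auto simp: S_def fun_eq_iff algebra_simps sum.distrib)
    show "S (r *\<^sub>R x) = r *\<^sub>R S x" for r
      by (auto simp: S_def fun_eq_iff scaleR_fun_def sum_distrib_left algebra_simps intro!: sum.cong)
  qed
  moreover have "tnorm (x i - x j) \<le> tnorm (S (x i) - S (x j)) \<and>
      tnorm (S (x i) - S (x j)) \<le> 48 * tnorm (x i - x j)" if ij: "i \<in> {1..n}" "j \<in> {1..n}" for i j
  proof -
    define e where "e = d (i, j)"
    define h where "h = (\<lambda>t. if t < m then e t else 0)"
    define \<tau> where "\<tau> = (\<lambda>t. if m \<le> t then e t else 0)"
    have e: "e \<in> tsirelson" unfolding e_def by (rule d) (use ij in auto)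
    have h: "h \<in> tsirelson" "tnorm h \<le> tnorm e" unfolding h_def by (rule restrict_tsirelson[OF e])+
    have \<tau>: "\<tau> \<in> tsirelson" "tnorm \<tau> \<le> tnorm e" unfolding \<tau>_def by (rule restrict_tsirelson[OF e])+
    obtain U where U: "U \<in> tsirelson"
      "U = (\<lambda>t. if m \<le> t \<and> t < 2 * m then \<Sum>s\<in>A. c (t - m) s * e s else 0)"
      "tnorm \<tau> \<le> 4 * tnorm U" "tnorm U \<le> 5 * tnorm \<tau>"
      using Ac[of "(i, j)"] ij unfolding e_def \<tau>_def by auto
    have e_eq: "x i - x j = e" by (auto simp: e_def d_def)
    have "S (x i) - S (x j) = (\<lambda>t. 8 * (h t + U t))"
      by (rule ext) (auto simp: S_def h_def U(2) e_def d_def algebra_simps sum_subtractf sum_distrib_left)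
    then have Se: "tnorm (S (x i) - S (x j)) = 8 * tnorm (\<lambda>t. h t + U t)"
      using tnorm_scale(2)[OF tnorm_triangle(1)[OF h(1) U(1)], of 8] by simp
    have hU: "(\<lambda>t. h t + U t) \<in> tsirelson" by (rule tnorm_triangle(1)[OF h(1) U(1)])
    have "h = (\<lambda>t. if t < m then h t + U t else 0)" by (auto simp: h_def U(2))
    then have 1: "tnorm h \<le> tnorm (\<lambda>t. h t + U t)"
      using restrict_tsirelson(2)[OF hU, of "\<lambda>t. t < m"] by simp
    have "U = (\<lambda>t. if m \<le> t then h t + U t else 0)" by (auto simp: h_def U(2))
    then have 2: "tnorm U \<le> tnorm (\<lambda>t. h t + U t)"
      using restrict_tsirelson(2)[OF hU, of "\<lambda>t. m \<le> t"] by simp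
    have "e = (\<lambda>t. h t + \<tau> t)" by (auto simp: h_def \<tau>_def)
    then have 3: "tnorm e \<le> tnorm h + tnorm \<tau>" using tnorm_triangle(2)[OF h(1) \<tau>(1)] by simp
    have 4: "tnorm (\<lambda>t. h t + U t) \<le> tnorm h + tnorm U" by (rule tnorm_triangle(2)[OF h(1) U(1)])
    \<comment> \<open>Lower bound: \<open>tnorm e\<close> is at most
      \<open>tnorm h + 4 * tnorm U\<close>, so at most 5 times the norm of \<open>h + U\<close>.
      Upper bound: \<open>8 * (1 + 5) = 48\<close>.\<close>
    show ?thesis
      unfolding e_eq Se using 1 2 3 4 U(3,4) h(2) \<tau>(2) tnorm_nonneg[OF hU] by linarith
  qed
  ultimately show ?thesis by blast
qed

theorem theorem1p2:
  shows "(\<exists>D K c :: real. D > 0 \<and> K > 0 \<and> c > 0 \<and>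
      (\<exists>(X :: (nat \<Rightarrow> real) set) (N :: (nat \<Rightarrow> real) \<Rightarrow> real).
        banach_space_on X N \<and>
        (\<forall>n::nat. n \<ge> 1 \<longrightarrow>
          (\<forall>x :: nat \<Rightarrow> (nat \<Rightarrow> real). (\<forall>i\<in>{1..n}. x i \<in> X) \<longrightarrow>
            (\<exists>F S. subspace F \<and> F \<subseteq> X \<and> finite_dim F \<and> real (dim F) \<le> K * ln (real n) \<and>
              linear_map_on X F S \<and>
              (\<forall>i\<in>{1..n}. \<forall>j\<in>{1..n}.
                N (x i - x j) \<le> N (S (x i) - S (x j)) \<and>
                N (S (x i) - S (x j)) \<le> D * N (x i - x j))))) \<and>
        (\<forall>n::nat. n \<ge> 1 \<longrightarrow>
          (\<exists>F. subspace F \<and> F \<subseteq> X \<and> finite_dim F \<and> dim F = n \<and>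
            euclidean_distortion F N \<ge> ereal (2 powr (c * real (inverse_ackermann n)))))))
    \<and> filterlim inverse_ackermann at_top sequentially"
\<comment> \<open>\<open>256 = 64 * 4\<close>, from dimension \<open>64 * p\<close> and
  \<open>p \<le> 4 * ln n\<close>.\<close>
proof (rule conjI[OF _ inverse_ackermann_at_top], rule exI[of _ 48], rule exI[of _ 256],
    rule exI[of _ "1 / 20"], intro conjI, simp, simp, simp, rule exI[of _ tsirelson],
    rule exI[of _ tnorm], intro conjI allI impI)
  show "banach_space_on tsirelson tnorm" by (rule tsirelson_banach)
next
  fix n :: nat and x :: "nat \<Rightarrow> nat \<Rightarrow> real"
  assume n: "1 \<le> n" and x: "\<forall>i\<in>{1..n}. x i \<in> tsirelson"
  show "\<exists>F S. subspace F \<and> F \<subseteq> tsirelson \<and> finite_dim F \<and> real (dim F) \<le> 256 * ln (real n) \<and>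
    linear_map_on tsirelson F S \<and>
    (\<forall>i\<in>{1..n}. \<forall>j\<in>{1..n}. tnorm (x i - x j) \<le> tnorm (S (x i) - S (x j)) \<and>
      tnorm (S (x i) - S (x j)) \<le> 48 * tnorm (x i - x j))"
  proof (cases "n = 1")
    \<comment> \<open>For one point \<open>ln n = 0\<close>, which forces the zero subspace.\<close>
    case True
    have "tnorm 0 = 0" using tnorm_zero(2) by (simp add: zero_fun_def)
    then have "linear_map_on tsirelson {0} (\<lambda>_. 0 :: nat \<Rightarrow> real) \<and>
      (\<forall>i\<in>{1..n}. \<forall>j\<in>{1..n}. tnorm (x i - x j) \<le> tnorm (0 - 0) \<and> tnorm (0 - 0) \<le> 48 * tnorm (x i - x j))"
      using True by (simp add: linear_map_on_def)
    moreover have "finite_dim {0 :: nat \<Rightarrow> real}" unfolding finite_dim_def by (rule exI[of _ "{}"]) simp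
    moreover have "0 \<in> tsirelson" using tnorm_zero(1) by (simp add: zero_fun_def)
    moreover have "dim {0 :: nat \<Rightarrow> real} = 0" using dim_unit_vecs[of 0] by simp
    ultimately show ?thesis
      using True by (intro exI[of _ "{0}"] exI[of _ "\<lambda>_. 0"]) (simp add: subspace_0)
  next
    case False
    then obtain p where p: "1 \<le> p" "n \<le> 2 ^ p" "real p \<le> 4 * ln (real n)"
      using exponent_exists[of n] n by auto
    let ?F = "span (unit_vec ` {..<64 * p})"
    have "finite_dim ?F" unfolding finite_dim_def by (rule exI[of _ "unit_vec ` {..<64 * p}"]) simp
    moreover have "real (dim ?F) \<le> 256 * ln (real n)" using p(3) unfolding dim_unit_vecs by simp
    ultimately show ?thesis
      using tsirelson_johnson_lindenstrauss[OF p(1,2), of x] x unit_span_tsirelson subspace_span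
      by (intro exI[of _ ?F]) blast
  qed
next
  fix n :: nat assume n: "1 \<le> n"
  let ?F = "span (unit_vec ` {..<n})"
  have "finite_dim ?F" unfolding finite_dim_def by (rule exI[of _ "unit_vec ` {..<n}"]) simp
  then show "\<exists>F. subspace F \<and> F \<subseteq> tsirelson \<and> finite_dim F \<and> dim F = n \<and>
    ereal (2 powr (1 / 20 * real (inverse_ackermann n))) \<le> euclidean_distortion F tnorm"
    using dim_unit_vecs distortion_ge_inverse_ackermann[OF n] unit_span_tsirelson subspace_span by blast
qed

end
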